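(* Let $A=A^*$ be a (possibly unbounded) selfadjoint operator in a Hilbert space $H$, let $T>0$, $h\in C([0,T];\mathbf{R})$, $f\in C([0,T];H)$, $u_0\in\mathcal{D}(A)$, $u_1\in H$. Then the problem $$u''(t)=\int_0^t h(t-s)Au(s)\,ds+f(t),\quad 0\le t\le T,\qquad u(0)=u_0,\quad u'(0)=u_1,$$ has at most one solution in $C^2([0,T];H)\cap C([0,T];\mathcal{D}(A))$. If in addition, for some $\Lambda>0$, $u_0,u_1\in H_\Lambda$ and $f\in C([0,T];H_\Lambda)$, then this problem has a solution in $C^2([0,T];H_\Lambda)$, and this solution is unique.
   Context: $\mathcal{D}(A)$ is the domain of $A$ with the graph norm. For $\Lambda>0$, $H_\Lambda=E_\Lambda H$ denotes the spectral subspace of $A$ cut off at level $\Lambda$, where $E_\Lambda$ is the spectral projection of $A$ onto $[-\Lambda,\Lambda]$; thus $H_\Lambda\subset\mathcal{D}(A)$ is a closed subspace invariant under $A$ and the restriction of $A$ to $H_\Lambda$ is bounded with $\|A\|_{H_\Lambda}\le\Lambda$. *)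

theory Defs
  imports "HOL-Analysis.Analysis"
begin

text \<open>The scalar field of a Hilbert space. The axioms leave only the fields of real and of complex
  numbers (both instances are below), so a statement for every field of this class is a statement for
  real and for complex Hilbert spaces.\<close>

class rc_field = real_normed_field +
  fixes rc_cnj :: "'a \<Rightarrow> 'a"
  assumes rc_cnj_add: "rc_cnj (z + w) = rc_cnj z + rc_cnj w"
    and rc_cnj_mult: "rc_cnj (z * w) = rc_cnj z * rc_cnj w"
    and rc_cnj_cnj: "rc_cnj (rc_cnj z) = z"
    and rc_add_cnj: "\<exists>r. z + rc_cnj z = r *\<^sub>R 1"
    and rc_mult_cnj: "z * rc_cnj z = (norm z)\<^sup>2 *\<^sub>R 1"

instantiation real :: rc_field
begin
definition rc_cnj_real :: "real \<Rightarrow> real" where "rc_cnj_real x = x"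
instance by standard (auto simp: rc_cnj_real_def power2_eq_square)
end

instantiation complex :: rc_field
begin
definition rc_cnj_complex :: "complex \<Rightarrow> complex" where "rc_cnj_complex = cnj"
instance
proof
  fix z w :: complex
  show "\<exists>r. z + rc_cnj z = r *\<^sub>R 1"
    by (rule exI[of _ "2 * Re z"]) (simp add: rc_cnj_complex_def complex_eq_iff)
  show "z * rc_cnj z = (norm z)\<^sup>2 *\<^sub>R 1"
    by (simp add: rc_cnj_complex_def complex_eq_iff cmod_power2 power2_eq_square[symmetric])
qed (simp_all add: rc_cnj_complex_def)
end

text \<open>A Hilbert space over \<open>'k\<close>. The type class \<open>real_inner\<close> provides the norm, the topology and
  the real inner product, which is the real part of \<open>ip\<close> by \<open>ip_self\<close> and polarization;
  \<open>ip\<close> is linear in the first argument.\<close>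

locale rc_hilbert = vector_space scl
  for scl :: "'k::rc_field \<Rightarrow> 'h::{real_inner, banach} \<Rightarrow> 'h" +
  fixes ip :: "'h \<Rightarrow> 'h \<Rightarrow> 'k"
  assumes scl_of_real: "scl (of_real r) x = r *\<^sub>R x"
    and ip_add_left: "ip (x + y) z = ip x z + ip y z"
    and ip_scl_left: "ip (scl c x) y = c * ip x y"
    and ip_commute: "ip y x = rc_cnj (ip x y)"
    and ip_self: "ip x x = of_real ((norm x)\<^sup>2)"

lemma rc_hilbert_real:
  "rc_hilbert scaleR (inner :: 'h::{real_inner, banach} \<Rightarrow> 'h \<Rightarrow> real)"
  by unfold_locales
    (simp_all add: scaleR_right_distrib scaleR_left_distrib inner_left_distrib rc_cnj_real_def
      power2_norm_eq_inner, simp add: inner_commute)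

lemma rc_hilbert_complex:
  "rc_hilbert ((*) :: complex \<Rightarrow> complex \<Rightarrow> complex) (\<lambda>z w. z * cnj w)"
proof unfold_locales
  fix x :: complex
  show "x * cnj x = of_real ((norm x)\<^sup>2)"
    by (metis complex_norm_square of_real_power)
qed (simp_all add: distrib_left distrib_right rc_cnj_complex_def scaleR_conv_of_real)

text \<open>An unbounded operator is a domain \<open>D\<close> with a total function \<open>A\<close> whose values outside \<open>D\<close> are
  irrelevant.\<close>

definition linear_operator ::
  "('k::rc_field \<Rightarrow> 'h::{real_inner, banach} \<Rightarrow> 'h) \<Rightarrow> 'h set \<Rightarrow> ('h \<Rightarrow> 'h) \<Rightarrow> bool" where
  "linear_operator scl D A \<longleftrightarrow> module.subspace scl D \<and>
     (\<forall>x\<in>D. \<forall>y\<in>D. A (x + y) = A x + A y) \<and> (\<forall>c. \<forall>x\<in>D. A (scl c x) = scl c (A x))"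

definition operator_graph :: "'h set \<Rightarrow> ('h \<Rightarrow> 'h) \<Rightarrow> ('h \<times> 'h) set" where
  "operator_graph D A = {(x, A x) | x. x \<in> D}"

definition adjoint_graph ::
  "('h \<Rightarrow> 'h \<Rightarrow> 'k) \<Rightarrow> 'h set \<Rightarrow> ('h \<Rightarrow> 'h) \<Rightarrow> ('h \<times> 'h) set" where
  "adjoint_graph ip D A = {(y, z). \<forall>x\<in>D. ip (A x) y = ip x z}"

definition selfadjoint_operator ::
  "('k::rc_field \<Rightarrow> 'h::{real_inner, banach} \<Rightarrow> 'h) \<Rightarrow> ('h \<Rightarrow> 'h \<Rightarrow> 'k) \<Rightarrow> 'h set \<Rightarrow> ('h \<Rightarrow> 'h) \<Rightarrow> bool"
  where
  "selfadjoint_operator scl ip D A \<longleftrightarrow>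
     linear_operator scl D A \<and> closure D = UNIV \<and> adjoint_graph ip D A = operator_graph D A"

definition orthogonal_projection ::
  "('k::rc_field \<Rightarrow> 'h::{real_inner, banach} \<Rightarrow> 'h) \<Rightarrow> ('h \<Rightarrow> 'h \<Rightarrow> 'k) \<Rightarrow> ('h \<Rightarrow> 'h) \<Rightarrow> bool" where
  "orthogonal_projection scl ip P \<longleftrightarrow> Vector_Spaces.linear scl scl P \<and>
     (\<forall>x. P (P x) = P x) \<and> (\<forall>x y. ip (P x) y = ip x (P y))"

text \<open>Only the values of \<open>E\<close> on Borel sets matter.\<close>

definition projection_valued_measure ::
  "('k::rc_field \<Rightarrow> 'h::{real_inner, banach} \<Rightarrow> 'h) \<Rightarrow> ('h \<Rightarrow> 'h \<Rightarrow> 'k) \<Rightarrow>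
     (real set \<Rightarrow> 'h \<Rightarrow> 'h) \<Rightarrow> bool" where
  "projection_valued_measure scl ip E \<longleftrightarrow>
     (\<forall>B\<in>sets borel. orthogonal_projection scl ip (E B)) \<and>
     (\<forall>x. E {} x = 0) \<and> (\<forall>x. E UNIV x = x) \<and>
     (\<forall>B\<in>sets borel. \<forall>C\<in>sets borel. \<forall>x. E (B \<inter> C) x = E B (E C x)) \<and>
     (\<forall>B. range B \<subseteq> sets borel \<and> disjoint_family B \<longrightarrow>
        (\<forall>x. (\<lambda>n::nat. E (B n) x) sums E (\<Union>n. B n) x))"

text \<open>The measure sending \<open>B\<close> to \<open>\<langle>E B x, x\<rangle>\<close>, a real number, hence equal to its real part
  \<open>E B x \<bullet> x\<close>.\<close>

definition scalar_measure :: "(real set \<Rightarrow> 'h::{real_inner, banach} \<Rightarrow> 'h) \<Rightarrow> 'h \<Rightarrow> real measure" where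
  "scalar_measure E x = measure_of UNIV (sets borel) (\<lambda>B. ennreal (E B x \<bullet> x))"

text \<open>\<open>A = \<integral>s dE(s)\<close>: by the spectral theorem every selfadjoint \<open>A\<close> has exactly one such \<open>E\<close>. The
  quadratic form suffices to describe \<open>A\<close> on its domain, by polarization.\<close>

definition spectral_measure_of ::
  "('k::rc_field \<Rightarrow> 'h::{real_inner, banach} \<Rightarrow> 'h) \<Rightarrow> ('h \<Rightarrow> 'h \<Rightarrow> 'k) \<Rightarrow> 'h set \<Rightarrow> ('h \<Rightarrow> 'h) \<Rightarrow>
     (real set \<Rightarrow> 'h \<Rightarrow> 'h) \<Rightarrow> bool" where
  "spectral_measure_of scl ip D A E \<longleftrightarrow> projection_valued_measure scl ip E \<and>
     D = {x. (\<integral>\<^sup>+s. ennreal (s\<^sup>2) \<partial>scalar_measure E x) < \<infinity>} \<and>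
     (\<forall>x\<in>D. ip (A x) x = of_real (\<integral>s. s \<partial>scalar_measure E x))"

definition spectral_subspace :: "(real set \<Rightarrow> 'h \<Rightarrow> 'h) \<Rightarrow> real \<Rightarrow> 'h set" where
  "spectral_subspace E \<Lambda> = range (E {-\<Lambda>..\<Lambda>})"

text \<open>Derivatives on \<open>[0,T]\<close> are one-sided at the end points.\<close>

definition time_deriv :: "real \<Rightarrow> (real \<Rightarrow> 'h::real_normed_vector) \<Rightarrow> real \<Rightarrow> 'h" where
  "time_deriv T u t = vector_derivative u (at t within {0..T})"

definition C2_into :: "real \<Rightarrow> 'h::real_normed_vector set \<Rightarrow> (real \<Rightarrow> 'h) \<Rightarrow> bool" where
  "C2_into T S u \<longleftrightarrow>
     (\<forall>t\<in>{0..T}. u t \<in> S \<and> time_deriv T u t \<in> S \<and> time_deriv T (time_deriv T u) t \<in> S \<and>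
        (u has_vector_derivative time_deriv T u t) (at t within {0..T}) \<and>
        (time_deriv T u has_vector_derivative time_deriv T (time_deriv T u) t) (at t within {0..T})) \<and>
     continuous_on {0..T} (time_deriv T (time_deriv T u))"

text \<open>\<open>C([0,T]; \<D>(A))\<close>: the norm of the pair \<open>(x, A x)\<close> in the product space is the graph norm of \<open>x\<close>.\<close>

definition C0_into_domain ::
  "real \<Rightarrow> 'h::real_normed_vector set \<Rightarrow> ('h \<Rightarrow> 'h) \<Rightarrow> (real \<Rightarrow> 'h) \<Rightarrow> bool" where
  "C0_into_domain T D A u \<longleftrightarrow>
     (\<forall>t\<in>{0..T}. u t \<in> D) \<and> continuous_on {0..T} (\<lambda>t. (u t, A (u t)))"

definition solves_problem ::
  "real \<Rightarrow> ('h \<Rightarrow> 'h) \<Rightarrow> (real \<Rightarrow> real) \<Rightarrow> (real \<Rightarrow> 'h) \<Rightarrow> 'h \<Rightarrow> 'h \<Rightarrow>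
     (real \<Rightarrow> 'h::{real_inner, banach}) \<Rightarrow> bool" where
  "solves_problem T A h f u0 u1 u \<longleftrightarrow>
     (\<forall>t\<in>{0..T}. time_deriv T (time_deriv T u) t =
        integral {0..t} (\<lambda>s. h (t - s) *\<^sub>R A (u s)) + f t) \<and>
     u 0 = u0 \<and> time_deriv T u 0 = u1"

end

theory Submission
  imports Defs
begin

text \<open>Integrating twice turns the problem into \<open>u = q + V (A u)\<close>, where \<open>V\<close> (\<open>volterra3 h\<close>) is the
  convolution with \<open>h\<close> followed by two integrations. Each application of \<open>V\<close> raises a bound
  \<open>t ^ n / n!\<close> to \<open>C t ^ (n + 3) / (n + 3)!\<close>. If \<open>A\<close> is bounded, the Neumann series of \<open>V A\<close>
  therefore converges; this gives existence in the spectral subspace, which is invariant under \<open>A\<close>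
  because \<open>\<langle>A x, x\<rangle>\<close> splits along \<open>x = P x + (x - P x)\<close>.

  Uniqueness needs no spectral theorem. The difference \<open>w\<close> of two solutions satisfies
  \<open>w = V (A w)\<close>. With the bounded regularization \<open>R = (1 + c\<^sup>2 A\<^sup>2)\<^sup>-\<^sup>1\<close> one has
  \<open>\<langle>w, R\<^sup>n x\<rangle> = V\<^sup>2 \<langle>w, A\<^sup>2 R\<^sup>n x\<rangle>\<close> and \<open>A\<^sup>2 R = (1 - R) / c\<^sup>2\<close>, so that
  \<open>\<langle>w (t), R\<^sup>n x\<rangle>\<close> is at most of order \<open>(C / c) ^ (2n) t ^ (6n) / (6n)!\<close>. On the other hand
  \<open>\<parallel>R\<^sup>n x - x\<parallel> \<le> n c \<parallel>A x\<parallel>\<close> for \<open>x\<close> in the domain. The choice \<open>c = e / n\<close> and \<open>n \<rightarrow> \<infinity>\<close> give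
  \<open>\<bar>\<langle>w (t), x\<rangle>\<bar> \<le> e \<parallel>w\<parallel> \<parallel>A x\<parallel>\<close> for all \<open>e > 0\<close>, hence \<open>w = 0\<close>.\<close>

subsection \<open>Volterra integral operators\<close>

definition volterra :: "(real \<Rightarrow> real) \<Rightarrow> (real \<Rightarrow> 'a::banach) \<Rightarrow> real \<Rightarrow> 'a" where
  "volterra h p t = integral {0..t} (\<lambda>s. h (t - s) *\<^sub>R p s)"

definition volterra3 :: "(real \<Rightarrow> real) \<Rightarrow> (real \<Rightarrow> 'a::banach) \<Rightarrow> real \<Rightarrow> 'a" where
  "volterra3 h p t = integral {0..t} (\<lambda>r. integral {0..r} (volterra h p))"

text \<open>The substitution \<open>s = t * s'\<close> moves the dependence on \<open>t\<close> from
  the range of integration into the integrand, so that continuity in \<open>t\<close> becomes a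
  statement about parameter integrals over a fixed interval.\<close>

lemma volterra_unit_interval:
  assumes "t \<ge> 0"
  shows "volterra h p t = t *\<^sub>R integral {0..1} (\<lambda>s. h (t - t * s) *\<^sub>R p (t * s))"
proof (cases "t = 0")
  case True
  then show ?thesis by (simp add: volterra_def)
next
  case False
  with assms have t: "t > 0" by simp
  have img: "(\<lambda>s. s / t) ` {0..t} = {0..1}"
  proof -
    have "x \<in> (\<lambda>s. s / t) ` {0..t}" if "x \<in> {0..1}" for x
      using that t by (intro image_eqI[of _ _ "t * x"]) (auto simp: mult_left_le)
    then show ?thesis using t by auto
  qed
  show ?thesis
    using integral_stretch_real[of t 0 t "\<lambda>s. h (t - s) *\<^sub>R p s"] t
    unfolding img volterra_def by simp
qed

lemma continuous_on_volterra:
  fixes p :: "real \<Rightarrow> 'a::banach"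
  assumes h: "continuous_on {0..T} h" and p: "continuous_on {0..T} p"
  shows "continuous_on {0..T} (volterra h p)"
proof -
  have r: "t * s \<in> {0..T}" "t - t * s \<in> {0..T}" if "t \<in> {0..T}" "s \<in> {0..1}" for s t :: real
    using that mult_left_le[of s t] by auto (smt (verit) mult_nonneg_nonneg)
  have "continuous_on ({0..T} \<times> cbox 0 1)
      (\<lambda>(t, s). h (t - t * s) *\<^sub>R p (t * s))"
    unfolding case_prod_beta
    by (intro continuous_on_scaleR continuous_on_compose2[OF h] continuous_on_compose2[OF p]
        continuous_intros) (use r in auto)
  then have "continuous_on {0..T} (\<lambda>t. t *\<^sub>R integral (cbox 0 1) (\<lambda>s. h (t - t * s) *\<^sub>R p (t * s)))"
    by (intro continuous_intros integral_continuous_on_param)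
  then show ?thesis
    by (subst continuous_on_cong[OF refl volterra_unit_interval]) auto
qed

lemma norm_integral_power_bound:
  fixes p :: "real \<Rightarrow> 'a::banach"
  assumes "t \<ge> 0" and b: "\<And>s. s \<in> {0..t} \<Longrightarrow> norm (p s) \<le> M * s ^ n / fact n"
  shows "norm (integral {0..t} p) \<le> M * t ^ Suc n / fact (Suc n)"
proof -
  have "((\<lambda>s. M * s ^ n / fact n) has_integral (M * t ^ Suc n / fact (Suc n) - M * 0 ^ Suc n / fact (Suc n))) {0..t}"
  proof (rule fundamental_theorem_of_calculus[OF assms(1)])
    fix x assume "x \<in> {0..t}"
    have "((\<lambda>s. M * s ^ Suc n / fact (Suc n)) has_real_derivative M * x ^ n / fact n) (at x within {0..t})"
      by (rule derivative_eq_intros refl | simp add: divide_simps)+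
    then show "((\<lambda>s. M * s ^ Suc n / fact (Suc n)) has_vector_derivative M * x ^ n / fact n) (at x within {0..t})"
      by (simp only: has_real_derivative_iff_has_vector_derivative)
  qed
  then have i: "((\<lambda>s. M * s ^ n / fact n) has_integral (M * t ^ Suc n / fact (Suc n))) {0..t}"
    by simp
  show ?thesis
  proof (cases "p integrable_on {0..t}")
    case True
    have "norm (integral {0..t} p) \<le> integral {0..t} (\<lambda>s. M * s ^ n / fact n)"
      by (rule integral_norm_bound_integral[OF True]) (use i b in \<open>auto intro: has_integral_integrable\<close>)
    then show ?thesis using i by (simp only: integral_unique)
  next
    case False
    \<comment> \<open>A non-integrable \<open>p\<close> has integral 0 by convention, so it suffices
      that the bound is nonnegative; it is, being the integral of a function that dominates a
      norm.\<close>
    have "0 \<le> integral {0..t} (\<lambda>s. M * s ^ n / fact n)"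
      by (rule integral_nonneg) (use i b in \<open>auto intro: has_integral_integrable order_trans[OF norm_ge_zero]\<close>)
    then show ?thesis unfolding integral_unique[OF i] not_integrable_integral[OF False] by simp
  qed
qed

text \<open>The convolution contributes the factor \<open>C\<close> and one power of
  \<open>t\<close>; each of the two outer integrations adds one more power.\<close>

lemma norm_volterra3_bound:
  fixes p :: "real \<Rightarrow> 'a::banach"
  assumes C: "\<And>s. s \<in> {0..T} \<Longrightarrow> \<bar>h s\<bar> \<le> C" and "t \<in> {0..T}"
    and b: "\<And>s. s \<in> {0..T} \<Longrightarrow> norm (p s) \<le> M * s ^ n / fact n"
  shows "norm (volterra3 h p t) \<le> C * M * t ^ (n + 3) / fact (n + 3)"
proof -
  have "norm (volterra h p r) \<le> (C * M) * r ^ Suc n / fact (Suc n)" if "r \<in> {0..T}" for r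
    unfolding volterra_def
  proof (rule norm_integral_power_bound)
    fix s assume s: "s \<in> {0..r}"
    have "norm (h (r - s) *\<^sub>R p s) \<le> C * (M * s ^ n / fact n)"
      unfolding norm_scaleR by (rule mult_mono) (use s that C[of "r - s"] b[of s] in auto)
    then show "norm (h (r - s) *\<^sub>R p s) \<le> C * M * s ^ n / fact n" by (simp add: mult.assoc)
  qed (use that in auto)
  then have "norm (integral {0..r} (volterra h p)) \<le> (C * M) * r ^ Suc (Suc n) / fact (Suc (Suc n))"
    if "r \<in> {0..T}" for r
    using that by (intro norm_integral_power_bound) (simp_all del: fact_Suc power_Suc)
  then have "norm (volterra3 h p t) \<le> (C * M) * t ^ Suc (Suc (Suc n)) / fact (Suc (Suc (Suc n)))"
    unfolding volterra3_def using assms(2)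
    by (intro norm_integral_power_bound[of t _ "C * M" "Suc (Suc n)"]) (simp_all del: fact_Suc power_Suc)
  then show ?thesis by (simp only: numeral_3_eq_3 add_Suc_right add_0_right)
qed

lemma continuous_on_integral_upper:
  fixes p :: "real \<Rightarrow> 'a::banach"
  assumes "continuous_on {0..T} p"
  shows "continuous_on {0..T} (\<lambda>t. integral {0..t} p)"
  using assms by (intro indefinite_integral_continuous_1 integrable_continuous_interval)

lemma continuous_on_volterra3:
  fixes p :: "real \<Rightarrow> 'a::banach"
  assumes "continuous_on {0..T} h" "continuous_on {0..T} p"
  shows "continuous_on {0..T} (volterra3 h p)"
  unfolding volterra3_def
  by (intro continuous_on_integral_upper continuous_on_volterra assms)

lemma volterra_integrable:
  fixes p :: "real \<Rightarrow> 'a::banach"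
  assumes h: "continuous_on {0..T} h" and p: "continuous_on {0..T} p" and "t \<in> {0..T}"
  shows "(\<lambda>s. h (t - s) *\<^sub>R p s) integrable_on {0..t}"
  by (intro integrable_continuous_interval continuous_on_scaleR continuous_on_compose2[OF h]
      continuous_on_subset[OF p] continuous_intros) (use assms(3) in auto)

text \<open>Used with the inner product against a fixed vector for uniqueness, and with the spectral
  projection for invariance of the subspace.\<close>

lemma bounded_linear_volterra3:
  fixes p :: "real \<Rightarrow> 'a::banach" and F :: "'a \<Rightarrow> 'b::banach"
  assumes F: "bounded_linear F"
    and h: "continuous_on {0..T} h" and p: "continuous_on {0..T} p" and t: "t \<in> {0..T}"
  shows "F (volterra3 h p t) = volterra3 h (\<lambda>s. F (p s)) t"
proof -
  interpret bounded_linear F by fact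
  have 1: "F (volterra h p r) = volterra h (\<lambda>s. F (p s)) r" if "r \<in> {0..T}" for r
    using integral_linear[OF volterra_integrable[OF h p that] F]
    by (simp add: volterra_def o_def scaleR)
  have 2: "F (integral {0..r} (volterra h p)) = integral {0..r} (volterra h (\<lambda>s. F (p s)))"
    if "r \<in> {0..T}" for r
  proof -
    have "volterra h p integrable_on {0..r}"
      by (intro integrable_continuous_interval continuous_on_subset[OF continuous_on_volterra[OF h p]])
        (use that in auto)
    from integral_linear[OF this F] have "F (integral {0..r} (volterra h p)) = integral {0..r} (\<lambda>r. F (volterra h p r))"
      by (simp add: o_def)
    also have "\<dots> = integral {0..r} (volterra h (\<lambda>s. F (p s)))"
      by (rule integral_cong) (use 1 that in auto)
    finally show ?thesis .
  qed
  have "(\<lambda>r. integral {0..r} (volterra h p)) integrable_on {0..t}"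
    by (intro integrable_continuous_interval continuous_on_subset[OF continuous_on_integral_upper[OF continuous_on_volterra[OF h p]]])
      (use t in auto)
  from integral_linear[OF this F] have "F (volterra3 h p t) = integral {0..t} (\<lambda>r. F (integral {0..r} (volterra h p)))"
    by (simp add: o_def volterra3_def)
  also have "\<dots> = volterra3 h (\<lambda>s. F (p s)) t"
    unfolding volterra3_def by (rule integral_cong) (use 2 t in auto)
  finally show ?thesis .
qed

lemma volterra_diff:
  fixes p q :: "real \<Rightarrow> 'a::banach"
  assumes h: "continuous_on {0..T} h" and "continuous_on {0..T} p" "continuous_on {0..T} q"
    and "t \<in> {0..T}"
  shows "volterra h (\<lambda>s. p s - q s) t = volterra h p t - volterra h q t"
  unfolding volterra_def scaleR_diff_right
  by (intro Henstock_Kurzweil_Integration.integral_diff volterra_integrable[OF h] assms)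

lemma volterra3_diff:
  fixes p q :: "real \<Rightarrow> 'a::banach"
  assumes h: "continuous_on {0..T} h" and p: "continuous_on {0..T} p" and q: "continuous_on {0..T} q"
    and t: "t \<in> {0..T}"
  shows "volterra3 h (\<lambda>s. p s - q s) t = volterra3 h p t - volterra3 h q t"
proof -
  have 1: "integral {0..r} (volterra h (\<lambda>s. p s - q s)) = integral {0..r} (volterra h p) - integral {0..r} (volterra h q)"
    if "r \<in> {0..T}" for r
  proof -
    have "integral {0..r} (volterra h (\<lambda>s. p s - q s)) = integral {0..r} (\<lambda>s. volterra h p s - volterra h q s)"
      by (rule integral_cong) (use that volterra_diff[OF h p q] in auto)
    also have "\<dots> = integral {0..r} (volterra h p) - integral {0..r} (volterra h q)"
      by (intro Henstock_Kurzweil_Integration.integral_diff integrable_continuous_interval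
         continuous_on_subset[OF continuous_on_volterra[OF h]] p q) (use that in auto)
    finally show ?thesis .
  qed
  have "volterra3 h (\<lambda>s. p s - q s) t = integral {0..t} (\<lambda>r. integral {0..r} (volterra h p) - integral {0..r} (volterra h q))"
    unfolding volterra3_def by (rule integral_cong) (use 1 t in auto)
  also have "\<dots> = volterra3 h p t - volterra3 h q t"
    unfolding volterra3_def
    by (intro Henstock_Kurzweil_Integration.integral_diff integrable_continuous_interval
         continuous_on_subset[OF continuous_on_integral_upper[OF continuous_on_volterra[OF h]]] p q) (use t in auto)
  finally show ?thesis .
qed

text \<open>The solution is the Neumann series with terms \<open>v n\<close>, the
  \<open>n\<close>-th iterate of \<open>volterra3 h\<close> after \<open>B\<close> applied to
  \<open>q\<close>. The bounds with \<open>fact (3 * n)\<close> give uniform convergence on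
  \<open>{0..T}\<close> for every \<open>T\<close>, without smallness of \<open>h\<close> or
  \<open>B\<close>.\<close>

lemma volterra3_fixpoint:
  fixes q :: "real \<Rightarrow> 'a::banach" and B :: "'a \<Rightarrow> 'a"
  assumes h: "continuous_on {0..T} h" and q: "continuous_on {0..T} q" and B: "bounded_linear B"
  shows "\<exists>u. continuous_on {0..T} u \<and> (\<forall>t\<in>{0..T}. u t = q t + volterra3 h (\<lambda>s. B (u s)) t)"
proof -
  interpret bounded_linear B by fact
  define v where "v = rec_nat q (\<lambda>_ p. volterra3 h (\<lambda>s. B (p s)))"
  have v0: "v 0 = q" and vS: "\<And>n. v (Suc n) = volterra3 h (\<lambda>s. B (v n s))"
    by (auto simp: v_def)
  have Bc: "continuous_on X (\<lambda>s. B (g s))" if "continuous_on X g" for X and g :: "real \<Rightarrow> 'a"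
    using that by (intro continuous_on_compose2[OF linear_continuous_on[OF B]]) auto
  have cv: "continuous_on {0..T} (v n)" for n
    by (induction n) (auto simp: v0 vS intro!: q continuous_on_volterra3[OF h] Bc)
  obtain C where C: "\<And>s. s \<in> {0..T} \<Longrightarrow> \<bar>h s\<bar> \<le> C"
    using compact_imp_bounded[OF compact_continuous_image[OF h compact_Icc]]
    by (force simp: bounded_iff)
  obtain M where M: "\<And>s. s \<in> {0..T} \<Longrightarrow> norm (q s) \<le> M"
    using compact_imp_bounded[OF compact_continuous_image[OF q compact_Icc]]
    by (force simp: bounded_iff)
  obtain L where L: "\<And>x. norm (B x) \<le> norm x * L" "L \<ge> 0" using nonneg_bounded by auto
  have bv: "norm (v n t) \<le> M * (C * L) ^ n * t ^ (3 * n) / fact (3 * n)" if "t \<in> {0..T}" for n t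
    using that
  proof (induction n arbitrary: t)
    case 0
    then show ?case using M by (simp add: v0)
  next
    case (Suc n)
    have "norm (v (Suc n) t) \<le> C * (M * (C * L) ^ n * L) * t ^ (3 * n + 3) / fact (3 * n + 3)"
      unfolding vS
    proof (rule norm_volterra3_bound[OF C Suc.prems])
      fix s assume s: "s \<in> {0..T}"
      have "norm (B (v n s)) \<le> norm (v n s) * L" by (rule L)
      also have "\<dots> \<le> (M * (C * L) ^ n * s ^ (3 * n) / fact (3 * n)) * L"
        by (rule mult_right_mono[OF Suc.IH[OF s] L(2)])
      finally show "norm (B (v n s)) \<le> M * (C * L) ^ n * L * s ^ (3 * n) / fact (3 * n)"
        by (simp add: mult_ac)
    qed auto
    then show ?case by (simp add: mult_ac add_ac)
  qed
  show ?thesis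
  proof (cases "0 \<le> T")
    case False
    then show ?thesis by auto
  next
    case True
    then have C0: "C \<ge> 0" and M0: "M \<ge> 0"
      using C[of 0] order_trans[OF norm_ge_zero M[of 0]] by auto
    have bv2: "norm (v n t) \<le> M * ((C * L * T ^ 3) ^ n / fact n)" if "t \<in> {0..T}" for n t
    proof -
      have "norm (v n t) \<le> M * (C * L) ^ n * t ^ (3 * n) / fact (3 * n)" by (rule bv[OF that])
      \<comment> \<open>Weakening \<open>fact (3 * n)\<close> to \<open>fact n\<close> turns the
        majorant into an exponential series.\<close>
      also have "\<dots> \<le> M * (C * L) ^ n * T ^ (3 * n) / fact n"
        using that C0 M0 L(2) by (intro frac_le mult_left_mono power_mono fact_mono) auto
      also have "\<dots> = M * ((C * L * T ^ 3) ^ n / fact n)"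
        by (simp add: power_mult_distrib power_mult)
      finally show ?thesis .
    qed
    have "summable (\<lambda>n. M * ((C * L * T ^ 3) ^ n / fact n))"
      using summable_exp[of "C * L * T ^ 3"] by (intro summable_mult) (simp add: field_simps)
    then have ul: "uniform_limit {0..T} (\<lambda>n t. \<Sum>i<n. v i t) (\<lambda>t. \<Sum>i. v i t) sequentially"
      by (intro Weierstrass_m_test[of _ _ "\<lambda>n. M * ((C * L * T ^ 3) ^ n / fact n)"] bv2) auto
    define u where "u = (\<lambda>t. \<Sum>i. v i t)"
    define U where "U = (\<lambda>n t. \<Sum>i<n. v i t)"
    have ul: "uniform_limit {0..T} U u sequentially" using ul by (simp add: U_def u_def)
    have cU: "continuous_on {0..T} (U n)" for n unfolding U_def by (intro continuous_intros cv)
    have cu: "continuous_on {0..T} u"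
      by (rule uniform_limit_theorem[OF _ ul]) (use cU in auto)
    \<comment> \<open>The partial sums are the Picard iterates: by linearity, passing from
      \<open>U n\<close> to \<open>U (Suc n)\<close> changes the Volterra term by exactly
      \<open>v (Suc n)\<close>. The fixed point equation is the limit of this recursion.\<close>
    have US: "U (Suc n) t = q t + volterra3 h (\<lambda>s. B (U n s)) t" if "t \<in> {0..T}" for n t
    proof (induction n)
      case 0
      then show ?case by (simp add: U_def v0 zero volterra3_def volterra_def[abs_def])
    next
      case (Suc n)
      have "volterra3 h (\<lambda>s. B (U (Suc n) s) - B (U n s)) t
         = volterra3 h (\<lambda>s. B (U (Suc n) s)) t - volterra3 h (\<lambda>s. B (U n s)) t"
        by (rule volterra3_diff[OF h Bc Bc that]) (rule cU)+
      moreover have "(\<lambda>s. B (U (Suc n) s) - B (U n s)) = (\<lambda>s. B (v n s))"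
        by (simp add: U_def add)
      ultimately have "v (Suc n) t = volterra3 h (\<lambda>s. B (U (Suc n) s)) t - volterra3 h (\<lambda>s. B (U n s)) t"
        by (simp add: vS)
      moreover have "U (Suc (Suc n)) t = U (Suc n) t + v (Suc n) t" by (simp add: U_def)
      ultimately show ?case using Suc by simp
    qed
    have "u t = q t + volterra3 h (\<lambda>s. B (u s)) t" if t: "t \<in> {0..T}" for t
    proof -
      have "(\<lambda>n. volterra3 h (\<lambda>s. B (U n s)) t) \<longlonglongrightarrow> volterra3 h (\<lambda>s. B (u s)) t"
      proof (rule LIMSEQ_I)
        fix e :: real assume e: "e > 0"
        \<comment> \<open>Uniform closeness \<open>d\<close> of \<open>U n\<close> to
          \<open>u\<close> changes the Volterra term by at most \<open>d * (C * L * T ^ 3)\<close>;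
          the summand 1 keeps the denominator positive and the final estimate strict.\<close>
        define d where "d = e / (C * L * T ^ 3 + 1)"
        have K: "C * L * T ^ 3 + 1 > 0" using C0 L(2) True by (intro add_nonneg_pos) auto
        have d: "d > 0" using e K by (simp add: d_def)
        obtain N where N: "\<And>n s. n \<ge> N \<Longrightarrow> s \<in> {0..T} \<Longrightarrow> dist (U n s) (u s) < d"
          using uniform_limitD[OF ul d] unfolding eventually_sequentially by blast
        have "norm (volterra3 h (\<lambda>s. B (U n s)) t - volterra3 h (\<lambda>s. B (u s)) t) < e" if "n \<ge> N" for n
        proof -
          have "norm (volterra3 h (\<lambda>s. B (U n s) - B (u s)) t) \<le> C * (d * L) * t ^ (0 + 3) / fact (0 + 3)"
          proof (rule norm_volterra3_bound[OF C t])
            fix s assume s: "s \<in> {0..T}"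
            have "norm (B (U n s) - B (u s)) \<le> norm (U n s - u s) * L"
              using L(1)[of "U n s - u s"] by (simp add: diff)
            also have "\<dots> \<le> d * L" using N[OF that s] L(2) by (intro mult_right_mono) (auto simp: dist_norm)
            finally show "norm (B (U n s) - B (u s)) \<le> d * L * s ^ 0 / fact 0" by simp
          qed auto
          also have "\<dots> \<le> C * (d * L) * T ^ 3 / 1"
            using t C0 L(2) d by (intro frac_le mult_left_mono power_mono) (auto simp: fact_numeral)
          also have "\<dots> < d * (C * L * T ^ 3 + 1)" using d by (simp add: algebra_simps)
          also have "\<dots> = e" using K by (simp add: d_def)
          finally show ?thesis using volterra3_diff[OF h Bc[OF cU] Bc[OF cu] t] by simp
        qed
        then show "\<exists>no. \<forall>n\<ge>no. norm (volterra3 h (\<lambda>s. B (U n s)) t - volterra3 h (\<lambda>s. B (u s)) t) < e"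
          by blast
      qed
      then have "(\<lambda>n. U (Suc n) t) \<longlonglongrightarrow> q t + volterra3 h (\<lambda>s. B (u s)) t"
        unfolding US[OF t] by (intro tendsto_intros)
      moreover have "(\<lambda>n. U (Suc n) t) \<longlonglongrightarrow> u t"
        using tendsto_uniform_limitI[OF ul t] by (rule LIMSEQ_Suc)
      ultimately show ?thesis by (rule LIMSEQ_unique[symmetric])
    qed
    with cu show ?thesis by blast
  qed
qed

subsection \<open>Selfadjoint operators and their resolvents\<close>

text \<open>A minimizing sequence for the distance to \<open>G\<close> is Cauchy by the
  parallelogram law, and its limit is the projection. The general type allows \<open>G\<close> to be
  a graph in the product space.\<close>

lemma orthogonal_projection_onto_closed_subspace:
  fixes G :: "'a::{real_inner, banach} set"
  assumes G: "subspace G" and "closed G"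
  shows "\<exists>p\<in>G. \<forall>g\<in>G. (x - p) \<bullet> g = 0"
proof -
  define d where "d = (INF g\<in>G. (norm (x - g))\<^sup>2)"
  have ne: "G \<noteq> {}" using subspace_0[OF G] by auto
  have bdd: "bdd_below ((\<lambda>g. (norm (x - g))\<^sup>2) ` G)" by (rule bdd_belowI2[of _ 0]) auto
  have d_le: "d \<le> (norm (x - g))\<^sup>2" if "g \<in> G" for g
    unfolding d_def by (rule cINF_lower[OF bdd that])
  have "\<exists>g\<in>G. (norm (x - g))\<^sup>2 < d + 1 / real (Suc n)" for n
    using cINF_less_iff[OF ne bdd, of "d + 1 / real (Suc n)"] unfolding d_def by auto
  then obtain g where gG: "\<And>n. g n \<in> G" and g: "\<And>n. (norm (x - g n))\<^sup>2 < d + 1 / real (Suc n)"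
    by metis
  have par: "(norm (g m - g n))\<^sup>2 \<le> 2 / real (Suc m) + 2 / real (Suc n)" for m n
  proof -
    \<comment> \<open>The midpoint lies in \<open>G\<close>, so its distance from \<open>x\<close>
      cannot undercut \<open>d\<close>; two nearly optimal points must then be close to each
      other.\<close>
    have "(1/2) *\<^sub>R (g m + g n) \<in> G" by (intro subspace_scale subspace_add gG G)
    then have "d \<le> (norm (x - (1/2) *\<^sub>R (g m + g n)))\<^sup>2" by (rule d_le)
    also have "\<dots> = (norm (x - g m))\<^sup>2 / 2 + (norm (x - g n))\<^sup>2 / 2 - (norm (g m - g n))\<^sup>2 / 4"
      by (simp add: power2_norm_eq_inner inner_diff inner_add inner_commute field_simps)
    finally show ?thesis using g[of m] g[of n] by linarith
  qed
  have "Cauchy g"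
  proof (rule metric_CauchyI)
    fix e :: real assume e: "e > 0"
    obtain N where N: "4 / e\<^sup>2 < real N" using reals_Archimedean2 by blast
    have "dist (g m) (g n) < e" if "m \<ge> N" "n \<ge> N" for m n
    proof -
      have *: "2 / real (Suc k) < e\<^sup>2 / 2" if "k \<ge> N" for k
        using N e that by (simp add: field_simps) (smt (verit, best) mult_right_mono of_nat_mono zero_le_power2)
      have "(norm (g m - g n))\<^sup>2 < e\<^sup>2" using par[of m n] *[OF that(1)] *[OF that(2)] by simp
      then show ?thesis using e by (simp add: dist_norm power_less_imp_less_base)
    qed
    then show "\<exists>M. \<forall>m\<ge>M. \<forall>n\<ge>M. dist (g m) (g n) < e" by blast
  qed
  then obtain p where p: "g \<longlonglongrightarrow> p" using Cauchy_convergent convergent_def by blast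
  then have pG: "p \<in> G" using \<open>closed G\<close> gG closed_sequentially by blast
  have "(norm (x - p))\<^sup>2 \<le> d"
  proof (rule LIMSEQ_le)
    show "(\<lambda>n. (norm (x - g n))\<^sup>2) \<longlonglongrightarrow> (norm (x - p))\<^sup>2" by (intro tendsto_intros p)
    show "(\<lambda>n. d + 1 / real (Suc n)) \<longlonglongrightarrow> d"
      using tendsto_add[OF tendsto_const LIMSEQ_inverse_real_of_nat, of d] by (simp add: inverse_eq_divide)
  qed (use g less_imp_le in blast)
  then have min: "(norm (x - p))\<^sup>2 \<le> (norm (x - q))\<^sup>2" if "q \<in> G" for q
    using d_le[OF that] by linarith
  have "(x - p) \<bullet> v = 0" if v: "v \<in> G" for v
  proof (cases "v = 0")
    case False
    \<comment> \<open>This \<open>r\<close> minimizes the quadratic polynomial that describes the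
      squared distance from \<open>x\<close> to \<open>p + r v\<close>.\<close>
    define r where "r = ((x - p) \<bullet> v) / (v \<bullet> v)"
    have vv: "v \<bullet> v > 0" using False by simp
    have "p + r *\<^sub>R v \<in> G" by (intro subspace_add subspace_scale G pG v)
    from min[OF this] have "0 \<le> r\<^sup>2 * (v \<bullet> v) - 2 * r * ((x - p) \<bullet> v)"
      unfolding power2_norm_eq_inner
      by (simp add: inner_diff inner_add inner_commute power2_eq_square algebra_simps)
    also have "\<dots> = - ((x - p) \<bullet> v)\<^sup>2 / (v \<bullet> v)"
      using vv by (simp add: r_def power2_eq_square field_simps)
    finally have "((x - p) \<bullet> v)\<^sup>2 \<le> 0" using vv by (simp add: field_simps)
    then show ?thesis by simp
  qed simp
  with pG show ?thesis by blast
qed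

text \<open>Each of the \<open>k\<close> factors of \<open>fact (n + k)\<close> beyond
  \<open>fact n\<close> is at least \<open>n\<close>.\<close>

lemma power_mult_fact_le: "n ^ k * fact n \<le> (fact (n + k) :: nat)"
proof (induction k)
  case (Suc k)
  have "n ^ Suc k * fact n = n * (n ^ k * fact n)" by simp
  also have "\<dots> \<le> Suc (n + k) * fact (n + k)" by (rule mult_le_mono[OF _ Suc]) simp
  finally show ?case by simp
qed simp

text \<open>Selfadjointness in terms of the real inner product alone, so that the scalar field can
  be forgotten. \<open>symmetric\<close> puts the graph of \<open>A\<close> into that of the
  adjoint; \<open>maximal\<close> is the reverse inclusion.\<close>

locale real_selfadjoint =
  fixes D :: "'h::{real_inner, banach} set" and A :: "'h \<Rightarrow> 'h"
  assumes subspace_D: "subspace D"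
    and A_add: "x \<in> D \<Longrightarrow> y \<in> D \<Longrightarrow> A (x + y) = A x + A y"
    and A_scale: "x \<in> D \<Longrightarrow> A (r *\<^sub>R x) = r *\<^sub>R A x"
    and symmetric: "x \<in> D \<Longrightarrow> y \<in> D \<Longrightarrow> A x \<bullet> y = x \<bullet> A y"
    and maximal: "(\<And>x. x \<in> D \<Longrightarrow> A x \<bullet> y = x \<bullet> z) \<Longrightarrow> y \<in> D \<and> A y = z"
begin

lemma A_diff: "x \<in> D \<Longrightarrow> y \<in> D \<Longrightarrow> A (x - y) = A x - A y"
  using A_add[of x "(-1) *\<^sub>R y"] A_scale[of y "-1"] subspace_scale[OF subspace_D, of y "-1"] by simp

lemma resolvent_exists:
  assumes "c > 0"
  shows "\<exists>y. y \<in> D \<and> A y \<in> D \<and> c\<^sup>2 *\<^sub>R A (A y) = x - y"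
proof -
  \<comment> \<open>The projection of \<open>(x, 0)\<close> onto the graph of \<open>c A\<close> is \<open>(y, c A y)\<close> with the required \<open>y\<close>.\<close>
  define G where "G = (\<lambda>y. (y, c *\<^sub>R A y)) ` D"
  have G: "subspace G"
  proof (rule subspaceI)
    show "0 \<in> G" using subspace_0[OF subspace_D] A_scale[of 0 0]
      by (auto simp: G_def zero_prod_def image_iff)
  qed (auto simp: G_def A_add A_scale subspace_D subspace_add subspace_scale scaleR_add_right
      image_iff mult.commute)
  have "closed G"
    unfolding closed_sequential_limits
  proof (intro allI impI, elim conjE)
    fix X l assume X: "\<forall>n. X n \<in> G" and l: "X \<longlonglongrightarrow> l"
    have XD: "fst (X n) \<in> D" "snd (X n) = c *\<^sub>R A (fst (X n))" for n
      using spec[OF X, of n] by (auto simp: G_def)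
    \<comment> \<open>Graphs of adjoints are closed: the adjoint condition against a fixed
      \<open>x\<close> in \<open>D\<close> survives limits, and \<open>maximal\<close> turns it back
      into membership in the graph.\<close>
    have "fst l \<in> D \<and> A (fst l) = (1 / c) *\<^sub>R snd l"
    proof (rule maximal)
      fix x assume x: "x \<in> D"
      have "(\<lambda>n. A x \<bullet> fst (X n)) \<longlonglongrightarrow> A x \<bullet> fst l" by (intro tendsto_intros l)
      moreover have "(\<lambda>n. x \<bullet> ((1 / c) *\<^sub>R snd (X n))) \<longlonglongrightarrow> x \<bullet> ((1 / c) *\<^sub>R snd l)"
        by (intro tendsto_intros l)
      moreover have "A x \<bullet> fst (X n) = x \<bullet> ((1 / c) *\<^sub>R snd (X n))" for n
        using symmetric[OF x XD(1)] XD(2) assms by simp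
      ultimately show "A x \<bullet> fst l = x \<bullet> ((1 / c) *\<^sub>R snd l)" by (simp add: LIMSEQ_unique)
    qed
    then show "l \<in> G" using assms by (auto simp: G_def image_iff prod_eq_iff)
  qed
  from orthogonal_projection_onto_closed_subspace[OF G this, of "(x, 0)"]
  obtain y where y: "y \<in> D" and o: "\<And>v. v \<in> D \<Longrightarrow> (x - y) \<bullet> v = (c *\<^sub>R A y) \<bullet> (c *\<^sub>R A v)"
    by (auto simp: G_def)
  \<comment> \<open>Orthogonality to the graph is the weak form of the equation; it says that
    \<open>A y\<close> satisfies the adjoint condition.\<close>
  have "A y \<in> D \<and> A (A y) = (1 / c\<^sup>2) *\<^sub>R (x - y)"
  proof (rule maximal)
    fix v assume "v \<in> D"
    from o[OF this] have "v \<bullet> (x - y) = c\<^sup>2 * (A v \<bullet> A y)"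
      by (simp add: power2_eq_square inner_commute)
    with assms show "A v \<bullet> A y = v \<bullet> ((1 / c\<^sup>2) *\<^sub>R (x - y))" by simp
  qed
  with y assms show ?thesis by auto
qed

section \<open>The regularization \<open>(1 + c\<^sup>2 A\<^sup>2)\<^sup>-\<^sup>1\<close> and its
  powers\<close>

definition resolvent :: "real \<Rightarrow> 'h \<Rightarrow> 'h" where
  "resolvent c x = (SOME y. y \<in> D \<and> A y \<in> D \<and> c\<^sup>2 *\<^sub>R A (A y) = x - y)"

context
  fixes c :: real
  assumes c: "c > 0"
begin

lemma resolvent_D: "resolvent c x \<in> D" "A (resolvent c x) \<in> D"
  and A_A_resolvent: "c\<^sup>2 *\<^sub>R A (A (resolvent c x)) = x - resolvent c x"
  using someI_ex[OF resolvent_exists[OF c, of x]] unfolding resolvent_def by auto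

text \<open>Pair the equation with \<open>y\<close> and move one \<open>A\<close> across by
  symmetry.\<close>

lemma resolvent_energy:
  assumes y: "y \<in> D" "A y \<in> D" "c\<^sup>2 *\<^sub>R A (A y) = x - y"
  shows "(norm y)\<^sup>2 + c\<^sup>2 * (norm (A y))\<^sup>2 = x \<bullet> y"
proof -
  have "(x - y) \<bullet> y = c\<^sup>2 * (A (A y) \<bullet> y)" unfolding y(3)[symmetric] by simp
  also have "A (A y) \<bullet> y = (norm (A y))\<^sup>2" using symmetric[OF y(2,1)] by (simp add: power2_norm_eq_inner)
  finally show ?thesis by (simp add: inner_diff power2_norm_eq_inner)
qed

text \<open>The defect \<open>?z\<close> solves the resolvent equation with right-hand side 0, so
  the energy identity forces it to vanish. The same argument shows that the choice made by
  \<open>SOME\<close> is the only one.\<close>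

lemma resolvent_diff: "resolvent c (x - y) = resolvent c x - resolvent c y"
proof -
  let ?R = "resolvent c"
  let ?z = "?R (x - y) - (?R x - ?R y)"
  note S = subspace_diff[OF subspace_D]
  have "(norm ?z)\<^sup>2 + c\<^sup>2 * (norm (A ?z))\<^sup>2 = 0 \<bullet> ?z"
    using A_A_resolvent[of "x - y"] A_A_resolvent[of x] A_A_resolvent[of y]
    by (intro resolvent_energy) (simp_all add: A_diff resolvent_D S scaleR_diff_right)
  then have "(norm ?z)\<^sup>2 = 0"
    by (smt (verit) inner_zero_left mult_nonneg_nonneg zero_le_power2)
  then show ?thesis by simp
qed

text \<open>The energy identity gives \<open>(norm ?y)\<^sup>2 \<le> x \<bullet> ?y\<close>;
  expanding the square of \<open>norm (x - ?y)\<close> then yields both contractions.\<close>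

lemma norm_resolvent: "norm (resolvent c x) \<le> norm x"
  and norm_diff_resolvent: "norm (x - resolvent c x) \<le> norm x"
proof -
  let ?y = "resolvent c x"
  have e: "(norm ?y)\<^sup>2 + c\<^sup>2 * (norm (A ?y))\<^sup>2 = x \<bullet> ?y"
    by (rule resolvent_energy[OF resolvent_D A_A_resolvent])
  have le: "(norm ?y)\<^sup>2 \<le> x \<bullet> ?y" using e by (smt (verit) mult_nonneg_nonneg zero_le_power2)
  have eq: "(norm (x - ?y))\<^sup>2 = (norm x)\<^sup>2 - 2 * (x \<bullet> ?y) + (norm ?y)\<^sup>2"
    by (simp add: power2_norm_eq_inner inner_diff inner_commute)
  have "(norm ?y)\<^sup>2 \<le> (norm x)\<^sup>2" using le eq zero_le_power2[of "norm (x - ?y)"] by linarith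
  then show "norm ?y \<le> norm x" by (rule power2_le_imp_le) simp
  have "(norm (x - ?y))\<^sup>2 \<le> (norm x)\<^sup>2" using le eq zero_le_power2[of "norm ?y"] by linarith
  then show "norm (x - ?y) \<le> norm x" by (rule power2_le_imp_le) simp
qed

text \<open>Since \<open>x - ?y\<close> is \<open>c\<^sup>2 A\<^sup>2 ?y\<close>, one
  \<open>A\<close> can be moved onto the second factor \<open>x - ?y\<close>; completing squares
  removes \<open>A ?y\<close>.\<close>

lemma norm_diff_resolvent_domain:
  assumes x: "x \<in> D"
  shows "norm (x - resolvent c x) \<le> c * norm (A x)"
proof -
  let ?y = "resolvent c x"
  have "(norm (x - ?y))\<^sup>2 = c\<^sup>2 * (A (A ?y) \<bullet> (x - ?y))"
    unfolding power2_norm_eq_inner by (subst A_A_resolvent[symmetric]) simp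
  also have "A (A ?y) \<bullet> (x - ?y) = A ?y \<bullet> A (x - ?y)"
    by (intro symmetric resolvent_D subspace_diff[OF subspace_D] x)
  also have "\<dots> = A ?y \<bullet> A x - A ?y \<bullet> A ?y" by (simp add: A_diff resolvent_D x inner_diff)
  also have "\<dots> \<le> (norm (A x))\<^sup>2"
  proof -
    have "0 \<le> (norm (A ?y - A x))\<^sup>2 + (norm (A ?y))\<^sup>2 + (norm (A x))\<^sup>2" by simp
    then show ?thesis by (simp add: power2_norm_eq_inner inner_diff inner_commute)
  qed
  finally have "(norm (x - ?y))\<^sup>2 \<le> (c * norm (A x))\<^sup>2"
    by (simp add: power_mult_distrib mult_left_mono)
  then show ?thesis by (rule power2_le_imp_le) (use c in simp)
qed

lemma resolvent_power_diff:
  "(resolvent c ^^ n) (x - y) = (resolvent c ^^ n) x - (resolvent c ^^ n) y"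
  by (induction n) (simp_all add: resolvent_diff)

lemma norm_resolvent_power: "norm ((resolvent c ^^ n) x) \<le> norm x"
  by (induction n) (auto intro: order_trans[OF norm_resolvent])

text \<open>Telescoping: each further power adds an error of at most that of the first, because the
  powers are contractions.\<close>

lemma norm_diff_resolvent_power:
  assumes "x \<in> D"
  shows "norm (x - (resolvent c ^^ n) x) \<le> real n * (c * norm (A x))"
proof (induction n)
  case (Suc n)
  let ?R = "resolvent c ^^ n"
  have "x - (resolvent c ^^ Suc n) x = (x - ?R x) + ?R (x - resolvent c x)"
    by (simp add: resolvent_power_diff funpow_swap1)
  also have "norm \<dots> \<le> norm (x - ?R x) + norm (x - resolvent c x)"
    by (intro norm_triangle_mono norm_resolvent_power order_refl)
  also have "\<dots> \<le> real n * (c * norm (A x)) + c * norm (A x)"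
    by (intro add_mono Suc.IH norm_diff_resolvent_domain assms)
  finally show ?case by (simp add: algebra_simps)
qed simp

lemma A_A_resolvent_power:
  "A (A ((resolvent c ^^ Suc n) x)) = (1 / c\<^sup>2) *\<^sub>R (resolvent c ^^ n) (x - resolvent c x)"
proof -
  let ?v = "(resolvent c ^^ n) x"
  have "A (A (resolvent c ?v)) = (1 / c\<^sup>2) *\<^sub>R (?v - resolvent c ?v)"
    using c by (simp add: A_A_resolvent[symmetric])
  then show ?thesis by (simp add: resolvent_power_diff funpow_swap1)
qed

end

text \<open>As \<open>A\<close> is unbounded, norms cannot be iterated through the equation. Inner
  products with \<open>(resolvent c ^^ n) x\<close> can: there two copies of \<open>A\<close> cost
  only a factor \<open>1 / c\<^sup>2\<close>.\<close>

lemma volterra3_homogeneous_unique: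
  assumes h: "continuous_on {0..T} h" and w: "continuous_on {0..T} w"
    and Aw: "continuous_on {0..T} (\<lambda>t. A (w t))"
    and wD: "\<And>t. t \<in> {0..T} \<Longrightarrow> w t \<in> D"
    and eq: "\<And>t. t \<in> {0..T} \<Longrightarrow> w t = volterra3 h (\<lambda>s. A (w s)) t"
    and t: "t \<in> {0..T}"
  shows "w t = 0"
proof -
  obtain C where C: "\<And>s. s \<in> {0..T} \<Longrightarrow> \<bar>h s\<bar> \<le> C"
    using compact_imp_bounded[OF compact_continuous_image[OF h compact_Icc]]
    by (force simp: bounded_iff)
  obtain W where W: "\<And>s. s \<in> {0..T} \<Longrightarrow> norm (w s) \<le> W"
    using compact_imp_bounded[OF compact_continuous_image[OF w compact_Icc]]
    by (force simp: bounded_iff)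
  have C0: "C \<ge> 0" and W0: "W \<ge> 0" using C[OF t] order_trans[OF norm_ge_zero W[OF t]] by auto
  \<comment> \<open>Pair the equation with \<open>y\<close> and move \<open>A\<close> from
    \<open>w\<close> to \<open>y\<close>: a bound against \<open>A y\<close> becomes a bound against
    \<open>y\<close> with three more powers of \<open>s\<close>.\<close>
  have step: "\<bar>w s \<bullet> y\<bar> \<le> C * M * s ^ (n + 3) / fact (n + 3)"
    if y: "y \<in> D" and s: "s \<in> {0..T}"
      and b: "\<And>s. s \<in> {0..T} \<Longrightarrow> \<bar>w s \<bullet> A y\<bar> \<le> M * s ^ n / fact n" for y M n s
  proof -
    have "w s \<bullet> y = volterra3 h (\<lambda>s. A (w s) \<bullet> y) s"
      by (subst eq[OF s], rule bounded_linear_volterra3[OF bounded_linear_inner_left h Aw s])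
    moreover have "norm (volterra3 h (\<lambda>s. A (w s) \<bullet> y) s) \<le> C * M * s ^ (n + 3) / fact (n + 3)"
      by (rule norm_volterra3_bound[OF C s]) (use b symmetric[OF wD y] in auto)
    ultimately show ?thesis by simp
  qed
  \<comment> \<open>The vector \<open>z\<close> must vary because the induction hypothesis is
    applied to \<open>z - resolvent c z\<close>. Two uses of \<open>step\<close>, at
    \<open>A y\<close> and then at \<open>y\<close>, account for the six powers and the square of
    \<open>C\<close>.\<close>
  have key: "\<bar>w s \<bullet> (resolvent c ^^ n) z\<bar> \<le> W * norm z * ((C / c)\<^sup>2) ^ n * s ^ (6 * n) / fact (6 * n)"
    if c: "c > 0" and s: "s \<in> {0..T}" for c n s z
    using s
  proof (induction n arbitrary: z s)
    case 0
    have "\<bar>w s \<bullet> z\<bar> \<le> norm (w s) * norm z" by (rule Cauchy_Schwarz_ineq2)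
    also have "\<dots> \<le> W * norm z" by (intro mult_right_mono W 0) simp
    finally show ?case by simp
  next
    case (Suc n)
    define y where "y = (resolvent c ^^ Suc n) z"
    define M where "M = (1 / c\<^sup>2) * (W * norm z * ((C / c)\<^sup>2) ^ n)"
    have y: "y \<in> D" "A y \<in> D" by (simp_all add: y_def resolvent_D[OF c])
    have b: "\<bar>w s \<bullet> A (A y)\<bar> \<le> M * s ^ (6 * n) / fact (6 * n)" if s: "s \<in> {0..T}" for s
    proof -
      have "\<bar>w s \<bullet> A (A y)\<bar> = (1 / c\<^sup>2) * \<bar>w s \<bullet> (resolvent c ^^ n) (z - resolvent c z)\<bar>"
        unfolding y_def A_A_resolvent_power[OF c] by (simp add: abs_mult)
      also have "\<dots> \<le> (1 / c\<^sup>2) * (W * norm (z - resolvent c z) * ((C / c)\<^sup>2) ^ n * s ^ (6 * n) / fact (6 * n))"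
        by (intro mult_left_mono Suc.IH s) simp
      also have "\<dots> \<le> (1 / c\<^sup>2) * (W * norm z * ((C / c)\<^sup>2) ^ n * s ^ (6 * n) / fact (6 * n))"
        by (intro mult_left_mono divide_right_mono mult_right_mono norm_diff_resolvent[OF c])
           (use W0 s in auto)
      finally show ?thesis by (simp add: M_def)
    qed
    have "\<bar>w s \<bullet> y\<bar> \<le> C * (C * M) * s ^ (6 * n + 3 + 3) / fact (6 * n + 3 + 3)"
      by (rule step[OF y(1) Suc.prems], rule step[OF y(2)]) (use b in auto)
    also have "6 * n + 3 + 3 = 6 * Suc n" by simp
    also have "C * (C * M) = W * norm z * ((C / c)\<^sup>2) ^ Suc n"
      by (simp add: M_def power2_eq_square)
    finally show ?case by (simp only: y_def)
  qed
  have small: "\<bar>w t \<bullet> x\<bar> \<le> W * (e * norm (A x))" if x: "x \<in> D" and e: "e > 0" for x e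
  proof -
    define a where "a = (C / e)\<^sup>2 * T ^ 6"
    have b: "\<bar>w t \<bullet> x\<bar> \<le> W * norm x * (a ^ n / fact n) + W * (e * norm (A x))" if n: "n > 0" for n
    proof -
      \<comment> \<open>This makes the regularization error \<open>n * c * norm (A x)\<close> equal
        to \<open>e * norm (A x)\<close>, at the price of a factor
        \<open>n ^ (2 * n)\<close>.\<close>
      define c where "c = e / real n"
      have c: "c > 0" using n e by (simp add: c_def)
      let ?y = "(resolvent c ^^ n) x"
      \<comment> \<open>The factorial absorbs \<open>n ^ (2 * n)\<close> and still leaves
        \<open>fact n\<close> in the denominator, so the first term of the bound tends to 0.\<close>
      have "real (n ^ (2 * n) * fact n) \<le> real (fact (n + 2 * n))"
        using power_mult_fact_le of_nat_mono by blast
      also have "\<dots> \<le> fact (6 * n)" by (simp add: fact_mono)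
      finally have f: "real n ^ (2 * n) / fact (6 * n) \<le> 1 / fact n" by (simp add: field_simps)
      have "\<bar>w t \<bullet> ?y\<bar> \<le> W * norm x * ((C / c)\<^sup>2) ^ n * t ^ (6 * n) / fact (6 * n)"
        by (rule key[OF c t])
      also have "\<dots> \<le> W * norm x * ((C / c)\<^sup>2) ^ n * T ^ (6 * n) / fact (6 * n)"
        using t W0 by (intro divide_right_mono mult_left_mono power_mono) auto
      also have "\<dots> = W * norm x * a ^ n * (real n ^ (2 * n) / fact (6 * n))"
        by (simp add: a_def c_def power_mult_distrib power_divide power_mult)
      also have "\<dots> \<le> W * norm x * a ^ n * (1 / fact n)"
        using f W0 t by (intro mult_left_mono) (auto simp: a_def)
      finally have 1: "\<bar>w t \<bullet> ?y\<bar> \<le> W * norm x * (a ^ n / fact n)" by simp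
      have "\<bar>w t \<bullet> (x - ?y)\<bar> \<le> norm (w t) * norm (x - ?y)" by (rule Cauchy_Schwarz_ineq2)
      also have "\<dots> \<le> W * (real n * (c * norm (A x)))"
        by (intro mult_mono W t norm_diff_resolvent_power[OF c] x W0) auto
      also have "real n * (c * norm (A x)) = e * norm (A x)" using n by (simp add: c_def)
      finally show ?thesis using 1 by (simp add: inner_diff)
    qed
    have "(\<lambda>n. W * norm x * (a ^ n / fact n) + W * (e * norm (A x))) \<longlonglongrightarrow> W * norm x * 0 + W * (e * norm (A x))"
      using summable_LIMSEQ_zero[OF summable_exp[of a]]
      by (intro tendsto_intros) (simp add: field_simps)
    then have "\<bar>w t \<bullet> x\<bar> \<le> W * norm x * 0 + W * (e * norm (A x))"
      by (rule LIMSEQ_le_const) (use b in \<open>auto intro!: exI[of _ 1]\<close>)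
    then show ?thesis by simp
  qed
  \<comment> \<open>\<open>w t\<close> lies in \<open>D\<close> and so is itself an admissible test
    vector. The summand 1 in \<open>K\<close> keeps the division by \<open>K\<close>
    legitimate.\<close>
  have "\<bar>w t \<bullet> w t\<bar> \<le> 0"
  proof (rule field_le_epsilon)
    fix d :: real assume d: "d > 0"
    define K where "K = W * norm (A (w t)) + 1"
    have K: "K > 0" using W0 by (simp add: K_def add_nonneg_pos)
    have "\<bar>w t \<bullet> w t\<bar> \<le> W * ((d / K) * norm (A (w t)))" by (rule small) (use wD[OF t] d K in auto)
    also have "\<dots> \<le> (d / K) * K" using d K by (simp only: K_def algebra_simps) (simp add: divide_simps)
    also have "\<dots> = d" using K by simp
    finally show "\<bar>w t \<bullet> w t\<bar> \<le> 0 + d" by simp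
  qed
  then show ?thesis using inner_gt_zero_iff[of "w t"] by linarith
qed

end

subsection \<open>Spectral subspaces\<close>

lemma rc_cnj_of_real: "rc_cnj (of_real r :: 'k::rc_field) = of_real r"
proof (cases "r = 0")
  case True
  \<comment> \<open>Zero cannot be cancelled as in the other case, so additivity is used
    instead.\<close>
  have "rc_cnj (0 :: 'k) = rc_cnj 0 + rc_cnj 0" using rc_cnj_add[of "0 :: 'k" 0] by simp
  then show ?thesis using True by simp
next
  case False
  have "of_real r * rc_cnj (of_real r :: 'k) = of_real r * of_real r"
    using rc_mult_cnj[of "of_real r :: 'k"]
    by (simp add: scaleR_conv_of_real power2_eq_square abs_mult_self flip: of_real_mult)
  then show ?thesis using False by simp
qed

section \<open>Comparison of \<open>ip\<close> with the real inner product\<close>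

context rc_hilbert
begin

lemma ip_add_right: "ip x (y + z) = ip x y + ip x z"
  by (metis ip_add_left ip_commute rc_cnj_add)

text \<open>Polarization: expand the square of \<open>norm (x + y)\<close> once by \<open>ip\<close>
  and once by the real inner product.\<close>

lemma ip_add_ip_commute: "ip x y + ip y x = of_real (2 * (x \<bullet> y))"
proof -
  have "of_real ((norm (x + y))\<^sup>2) = ip (x + y) (x + y)" by (simp only: ip_self)
  also have "\<dots> = ip x y + ip y x + of_real ((norm x)\<^sup>2) + of_real ((norm y)\<^sup>2)"
    by (simp only: ip_add_left ip_add_right ip_self[of x] ip_self[of y] ac_simps)
  finally have "ip x y + ip y x = of_real ((norm (x + y))\<^sup>2 - (norm x)\<^sup>2 - (norm y)\<^sup>2)"
    by simp
  also have "(norm (x + y))\<^sup>2 - (norm x)\<^sup>2 - (norm y)\<^sup>2 = 2 * (x \<bullet> y)"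
    by (simp add: power2_norm_eq_inner inner_add inner_commute)
  finally show ?thesis .
qed

lemma inner_cong_ip:
  assumes "ip x y = ip x' y'"
  shows "x \<bullet> y = x' \<bullet> y'"
proof -
  have "of_real (2 * (x \<bullet> y)) = (of_real (2 * (x' \<bullet> y')) :: 'k)"
    using assms by (metis ip_add_ip_commute ip_commute)
  then show ?thesis by (simp only: of_real_eq_iff)
qed

lemma inner_eq_ip_of_real:
  assumes "ip x y = of_real r"
  shows "x \<bullet> y = r"
proof -
  have "of_real (2 * (x \<bullet> y)) = (of_real (2 * r) :: 'k)"
    using assms ip_commute[of y x] ip_add_ip_commute[of x y] by (simp add: rc_cnj_of_real)
  then show ?thesis by (simp only: of_real_eq_iff)
qed

lemma real_subspace: "subspace S \<Longrightarrow> Real_Vector_Spaces.subspace S"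
  unfolding real_vector.subspace_def by (metis scl_of_real subspace_0 subspace_add subspace_scale)

lemma ip_eq_of_inner_eq:
  assumes "linear_operator scl D A" and eq: "\<And>x. x \<in> D \<Longrightarrow> A x \<bullet> y = x \<bullet> z" and x: "x \<in> D"
  shows "ip (A x) y = ip x z"
proof -
  define d where "d = ip (A x) y - ip x z"
  \<comment> \<open>Testing with \<open>rc_cnj d\<close> times \<open>x\<close> makes the difference real and nonnegative.\<close>
  define x' where "x' = scl (rc_cnj d) x"
  have x': "x' \<in> D" "A x' = scl (rc_cnj d) (A x)"
    using assms(1) x subspace_scale by (auto simp: x'_def linear_operator_def)
  have 1: "ip (A x') y - ip x' z = d * rc_cnj d"
    unfolding x'(2) by (simp add: x'_def ip_scl_left d_def algebra_simps)
  have 2: "ip y (A x') - ip z x' = d * rc_cnj d"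
  proof -
    have "ip (A x') y = d * rc_cnj d + ip x' z" using 1 by (simp add: algebra_simps)
    then have "ip y (A x') = rc_cnj (d * rc_cnj d) + ip z x'"
      by (metis ip_commute rc_cnj_add)
    then show ?thesis by (simp add: rc_cnj_mult rc_cnj_cnj mult.commute)
  qed
  \<comment> \<open>After regrouping, each bracket is twice a real inner product, and these agree at
    \<open>x'\<close> by assumption.\<close>
  have "2 * (d * rc_cnj d) = (ip (A x') y + ip y (A x')) - (ip x' z + ip z x')"
    unfolding mult_2 by (subst 1[symmetric], subst 2[symmetric]) (simp add: algebra_simps)
  also have "\<dots> = 0" by (simp only: ip_add_ip_commute eq[OF x'(1)] diff_self)
  finally have "d * rc_cnj d = 0" by simp
  then have "d = 0" by (simp add: rc_mult_cnj)
  then show ?thesis by (simp add: d_def)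
qed

text \<open>Testing only real parts might enlarge the adjoint; \<open>ip_eq_of_inner_eq\<close>
  excludes this and thereby gives \<open>maximal\<close>.\<close>

lemma real_selfadjoint_if_selfadjoint:
  assumes "selfadjoint_operator scl ip D A"
  shows "real_selfadjoint D A"
proof
  have L: "linear_operator scl D A" and G: "adjoint_graph ip D A = operator_graph D A"
    using assms by (auto simp: selfadjoint_operator_def)
  show "Real_Vector_Spaces.subspace D" using L real_subspace by (auto simp: linear_operator_def)
  show "A (x + y) = A x + A y" if "x \<in> D" "y \<in> D" for x y
    using L that by (auto simp: linear_operator_def)
  show "A (r *\<^sub>R x) = r *\<^sub>R A x" if "x \<in> D" for x r
    using L that by (metis linear_operator_def scl_of_real)
  show "A x \<bullet> y = x \<bullet> A y" if "x \<in> D" "y \<in> D" for x y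
  proof (rule inner_cong_ip)
    have "(y, A y) \<in> adjoint_graph ip D A" using that by (auto simp: G operator_graph_def)
    then show "ip (A x) y = ip x (A y)" using that by (auto simp: adjoint_graph_def)
  qed
  show "y \<in> D \<and> A y = z" if "\<And>x. x \<in> D \<Longrightarrow> A x \<bullet> y = x \<bullet> z" for y z
  proof -
    have "(y, z) \<in> adjoint_graph ip D A"
      using ip_eq_of_inner_eq[OF L that] by (auto simp: adjoint_graph_def)
    then show ?thesis by (auto simp: G operator_graph_def)
  qed
qed

lemma orthogonal_projection_inner:
  "orthogonal_projection scl ip P \<Longrightarrow> P x \<bullet> y = x \<bullet> P y"
  by (rule inner_cong_ip) (simp add: orthogonal_projection_def)

lemma orthogonal_projection_idem: "orthogonal_projection scl ip P \<Longrightarrow> P (P x) = P x"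
  by (simp add: orthogonal_projection_def)

lemma bounded_linear_orthogonal_projection:
  assumes "orthogonal_projection scl ip P"
  shows "bounded_linear P"
proof (rule bounded_linear_intro[where K = 1])
  interpret P: Vector_Spaces.linear scl scl P using assms by (simp add: orthogonal_projection_def)
  show "P (x + y) = P x + P y" for x y by (rule P.add)
  show "P (r *\<^sub>R x) = r *\<^sub>R P x" for r x by (metis P.scale scl_of_real)
  show "norm (P x) \<le> norm x * 1" for x
  proof (cases "P x = 0")
    case False
    have "norm (P x) * norm (P x) = P x \<bullet> x"
      using orthogonal_projection_inner[OF assms, of "P x" x] orthogonal_projection_idem[OF assms]
      by (simp add: power2_norm_eq_inner[symmetric] power2_eq_square)
    also have "\<dots> \<le> norm (P x) * norm x" by (rule norm_cauchy_schwarz)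
    finally show ?thesis using False by simp
  qed simp
qed

end

section \<open>Scalar spectral measures and the operator cut off at \<open>\<Lambda>\<close>\<close>

locale rc_spectral = rc_hilbert scl ip + real_selfadjoint D A
  for scl :: "'k::rc_field \<Rightarrow> 'h::{real_inner, banach} \<Rightarrow> 'h" and ip :: "'h \<Rightarrow> 'h \<Rightarrow> 'k"
    and D :: "'h set" and A :: "'h \<Rightarrow> 'h" +
  fixes E :: "real set \<Rightarrow> 'h \<Rightarrow> 'h"
  assumes spectral: "spectral_measure_of scl ip D A E"
begin

lemma pvm: "projection_valued_measure scl ip E"
  using spectral by (simp add: spectral_measure_of_def)

lemma E_projection: "B \<in> sets borel \<Longrightarrow> orthogonal_projection scl ip (E B)"
  using pvm by (auto simp: projection_valued_measure_def)

lemma E_Int: "B \<in> sets borel \<Longrightarrow> C \<in> sets borel \<Longrightarrow> E (B \<inter> C) x = E B (E C x)"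
  using pvm by (auto simp: projection_valued_measure_def)

lemma E_UNIV: "E UNIV x = x"
  using pvm by (auto simp: projection_valued_measure_def)

lemma E_sums: "range B \<subseteq> sets borel \<Longrightarrow> disjoint_family B \<Longrightarrow> (\<lambda>n::nat. E (B n) x) sums E (\<Union>n. B n) x"
  using pvm by (auto simp: projection_valued_measure_def)

lemma E_inner_self: "B \<in> sets borel \<Longrightarrow> E B x \<bullet> x = (norm (E B x))\<^sup>2"
  by (metis E_projection orthogonal_projection_idem orthogonal_projection_inner power2_norm_eq_inner)

lemma sets_scalar_measure [measurable_cong, simp]: "sets (scalar_measure E x) = sets borel"
  unfolding scalar_measure_def by (metis sets.sets_measure_of_eq space_borel)

lemma space_scalar_measure [simp]: "space (scalar_measure E x) = UNIV"
  by (simp add: scalar_measure_def space_measure_of_conv)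

text \<open>\<open>measure_of\<close> returns the given set function only once countable additivity
  is checked. It follows from the vector-valued sums of \<open>E\<close>, whose terms paired with
  \<open>x\<close> are squared norms.\<close>

lemma emeasure_scalar_measure:
  assumes "B \<in> sets borel"
  shows "emeasure (scalar_measure E x) B = ennreal (E B x \<bullet> x)"
  unfolding scalar_measure_def
proof (rule emeasure_measure_of_sigma[OF _ _ _ assms])
  show "sigma_algebra UNIV (sets (borel :: real measure))"
    by (metis sets.sigma_algebra_axioms space_borel)
  show "positive (sets borel) (\<lambda>B. ennreal (E B x \<bullet> x))"
    using pvm by (simp add: positive_def projection_valued_measure_def)
  show "countably_additive (sets borel) (\<lambda>B. ennreal (E B x \<bullet> x))"
  proof (rule countably_additiveI)
    fix B :: "nat \<Rightarrow> real set"
    assume B: "range B \<subseteq> sets borel" "disjoint_family B"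
    have "(\<lambda>n. E (B n) x \<bullet> x) sums (E (\<Union>n. B n) x \<bullet> x)"
      by (rule bounded_linear.sums[OF bounded_linear_inner_left E_sums[OF B]])
    then show "(\<Sum>n. ennreal (E (B n) x \<bullet> x)) = ennreal (E (\<Union>n. B n) x \<bullet> x)"
      using B by (intro suminf_ennreal_eq) (auto simp: E_inner_self)
  qed
qed

lemma emeasure_scalar_measure_UNIV: "emeasure (scalar_measure E x) UNIV = ennreal ((norm x)\<^sup>2)"
  by (simp add: emeasure_scalar_measure E_UNIV power2_norm_eq_inner)

lemma finite_scalar_measure: "finite_measure (scalar_measure E x)"
  by (rule finite_measureI) (simp add: emeasure_scalar_measure_UNIV)

text \<open>Multiplicativity of \<open>E\<close> restricts the measure of \<open>x\<close> to
  \<open>C\<close>, so integrals for \<open>E C x\<close> become integrals for \<open>x\<close> with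
  an indicator.\<close>

lemma scalar_measure_E:
  assumes C: "C \<in> sets borel"
  shows "scalar_measure E (E C x) = density (scalar_measure E x) (\<lambda>s. ennreal (indicator C s))"
proof (rule measure_eqI)
  fix B assume "B \<in> sets (scalar_measure E (E C x))"
  then have B: "B \<in> sets borel" by simp
  have "emeasure (density (scalar_measure E x) (\<lambda>s. ennreal (indicator C s))) B
      = (\<integral>\<^sup>+s. indicator (C \<inter> B) s \<partial>scalar_measure E x)"
    using B C by (simp add: emeasure_density ennreal_indicator indicator_inter_arith del: nn_integral_indicator nn_integral_indicator')
  also have "\<dots> = ennreal (E (C \<inter> B) x \<bullet> x)"
    using B C by (subst nn_integral_indicator) (auto simp: emeasure_scalar_measure)
  also have "E (C \<inter> B) x \<bullet> x = E B (E C x) \<bullet> E C x"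
  proof -
    have "E B (E C x) \<bullet> E C x = E C (E B (E C x)) \<bullet> x"
      using orthogonal_projection_inner[OF E_projection[OF C]] by simp
    also have "E C (E B (E C x)) = E (C \<inter> B) x"
      using B C by (simp add: E_Int[symmetric] Int_ac)
    finally show ?thesis by simp
  qed
  finally show "emeasure (scalar_measure E (E C x)) B
      = emeasure (density (scalar_measure E x) (\<lambda>s. ennreal (indicator C s))) B"
    using B by (simp add: emeasure_scalar_measure)
qed simp

lemma quadratic_form: "x \<in> D \<Longrightarrow> A x \<bullet> x = (\<integral>s. s \<partial>scalar_measure E x)"
  using spectral by (intro inner_eq_ip_of_real) (auto simp: spectral_measure_of_def)

lemma integrable_scalar_measure:
  assumes "x \<in> D"
  shows "integrable (scalar_measure E x) (\<lambda>s. s)"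
proof -
  interpret finite_measure "scalar_measure E x" by (rule finite_scalar_measure)
  have "(\<integral>\<^sup>+s. ennreal (s\<^sup>2) \<partial>scalar_measure E x) < \<infinity>"
    using spectral assms by (auto simp: spectral_measure_of_def)
  then have "integrable (scalar_measure E x) (\<lambda>s. s\<^sup>2)"
    by (intro integrableI_bounded) auto
  then have "integrable (scalar_measure E x) (\<lambda>s. 1 + s\<^sup>2)" by simp
  then show ?thesis
  proof (rule Bochner_Integration.integrable_bound)
    have "\<bar>s\<bar> \<le> 1 + s\<^sup>2" for s :: real
      using zero_le_power2[of "\<bar>s\<bar> - 1"] zero_le_power2[of s] unfolding power2_diff by simp
    then show "AE s in scalar_measure E x. norm s \<le> norm (1 + s\<^sup>2)" by simp
  qed simp
qed

lemma integral_scalar_measure_E: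
  assumes C: "C \<in> sets borel"
  shows "(\<integral>s. s \<partial>scalar_measure E (E C x)) = (\<integral>s. indicator C s * s \<partial>scalar_measure E x)"
  unfolding scalar_measure_E[OF C] using C by (subst integral_density) auto

text \<open>On the interval \<open>s\<^sup>2\<close> is at most \<open>\<Lambda>\<^sup>2\<close>,
  and the scalar measure is finite.\<close>

lemma E_mem_D: "E {-\<Lambda>..\<Lambda>} x \<in> D"
proof -
  let ?C = "{-\<Lambda>..\<Lambda>}"
  have "(\<integral>\<^sup>+s. ennreal (s\<^sup>2) \<partial>scalar_measure E (E ?C x))
      = (\<integral>\<^sup>+s. ennreal (indicator ?C s) * ennreal (s\<^sup>2) \<partial>scalar_measure E x)"
    unfolding scalar_measure_E[OF borel_closed[OF closed_atLeastAtMost]] by (subst nn_integral_density) auto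
  also have "\<dots> \<le> (\<integral>\<^sup>+s. ennreal (\<Lambda>\<^sup>2) \<partial>scalar_measure E x)"
    by (rule nn_integral_mono) (auto simp: indicator_def abs_le_square_iff[symmetric])
  also have "\<dots> < \<infinity>"
    by (simp add: emeasure_scalar_measure_UNIV ennreal_mult_less_top)
  finally show ?thesis using spectral by (simp add: spectral_measure_of_def)
qed

lemma E_linear: "B \<in> sets borel \<Longrightarrow> bounded_linear (E B)"
  by (rule bounded_linear_orthogonal_projection[OF E_projection])

lemma E_compl:
  assumes "C \<in> sets borel"
  shows "E (- C) x = x - E C x"
proof -
  \<comment> \<open>Finite additivity is obtained from countable additivity by padding with empty
    sets, on which \<open>E\<close> vanishes.\<close>
  have B: "range (\<lambda>n::nat. if n = 0 then C else if n = 1 then - C else {}) \<subseteq> sets borel"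
    "disjoint_family (\<lambda>n::nat. if n = 0 then C else if n = 1 then - C else {})"
    using assms by (auto simp: disjoint_family_on_def)
  have U: "(\<Union>n::nat. if n = 0 then C else if n = 1 then - C else {}) = UNIV"
    by (auto split: if_splits)
  have "(\<lambda>n. E (if n = 0 then C else if n = 1 then - C else {}) x) sums x"
    using E_sums[OF B, of x] unfolding U E_UNIV .
  moreover have "(\<lambda>n. E (if n = 0 then C else if n = 1 then - C else {}) x)
     sums (\<Sum>n\<in>{0,1::nat}. E (if n = 0 then C else if n = 1 then - C else {}) x)"
    by (rule sums_finite) (use pvm in \<open>auto simp: projection_valued_measure_def\<close>)
  ultimately have "x = E C x + E (- C) x" using sums_unique2 by force
  then show ?thesis by (metis add_diff_cancel_left')
qed

text \<open>The integral splits over \<open>C\<close> and its complement. Since \<open>E\<close>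
  determines \<open>A\<close> here only through the quadratic form, this is the source of invariance
  under \<open>A\<close>.\<close>

lemma quadratic_form_split:
  assumes x: "x \<in> D" and C: "C \<in> sets borel" and "E C x \<in> D"
  shows "A x \<bullet> x = A (E C x) \<bullet> E C x + A (x - E C x) \<bullet> (x - E C x)"
proof -
  have i: "integrable (scalar_measure E x) (\<lambda>s. indicator B s * s)" if "B \<in> sets borel" for B
    using integrable_real_mult_indicator[OF _ integrable_scalar_measure[OF x], of B] that
    by (simp add: mult.commute)
  have "A x \<bullet> x = (\<integral>s. indicator C s * s + indicator (- C) s * s \<partial>scalar_measure E x)"
    unfolding quadratic_form[OF x] by (rule Bochner_Integration.integral_cong) (auto simp: indicator_def)
  also have "\<dots> = (\<integral>s. indicator C s * s \<partial>scalar_measure E x) + (\<integral>s. indicator (- C) s * s \<partial>scalar_measure E x)"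
    using C by (intro Bochner_Integration.integral_add i) auto
  also have "\<dots> = A (E C x) \<bullet> E C x + A (E (- C) x) \<bullet> E (- C) x"
  proof -
    have "E (- C) x \<in> D" unfolding E_compl[OF C] by (intro real_vector.subspace_diff[OF subspace_D] x assms(3))
    then show ?thesis using assms(3) C by (simp add: quadratic_form integral_scalar_measure_E)
  qed
  finally show ?thesis by (simp add: E_compl[OF C])
qed

lemma A_E_commute: "E {-\<Lambda>..\<Lambda>} (A (E {-\<Lambda>..\<Lambda>} x)) = A (E {-\<Lambda>..\<Lambda>} x)"
proof -
  define P where "P = E {-\<Lambda>..\<Lambda>}"
  have C: "{-\<Lambda>..\<Lambda>} \<in> sets borel" by simp
  interpret P: bounded_linear P unfolding P_def by (rule E_linear[OF C])
  have PP: "P (P v) = P v" for v unfolding P_def by (rule orthogonal_projection_idem[OF E_projection[OF C]])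
  have PD: "P v \<in> D" for v unfolding P_def by (rule E_mem_D)
  have Ps: "P v \<bullet> v' = v \<bullet> P v'" for v v'
    unfolding P_def by (rule orthogonal_projection_inner[OF E_projection[OF C]])
  \<comment> \<open>Splitting the form at \<open>P x + y\<close> kills the sum of the two cross
    terms, which are equal by symmetry.\<close>
  have orth: "A (P x) \<bullet> y = 0" if y: "y \<in> D" "P y = 0" for y
  proof -
    have "A (P x + y) \<bullet> (P x + y) = A (P x) \<bullet> P x + A y \<bullet> y"
      using quadratic_form_split[OF real_vector.subspace_add[OF subspace_D PD y(1)] C, of x] PD[of "P x + y"]
      unfolding P_def[symmetric] by (simp add: P.add PP y)
    then have "A (P x) \<bullet> y + A y \<bullet> P x = 0" by (simp add: A_add PD y inner_add)
    moreover have "A y \<bullet> P x = A (P x) \<bullet> y" using symmetric[OF y(1) PD, of x] by (simp add: inner_commute)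
    ultimately show ?thesis by simp
  qed
  \<comment> \<open>The defect is orthogonal to \<open>D\<close>, so it is an adjoint value at 0,
    and \<open>maximal\<close> identifies it with \<open>A 0\<close>.\<close>
  have "A 0 = A (P x) - P (A (P x))"
  proof (rule conjunct2[OF maximal])
    fix v assume v: "v \<in> D"
    have "A (P x) \<bullet> (v - P v) = 0"
      by (rule orth) (auto simp: real_vector.subspace_diff subspace_D v PD P.diff PP)
    then show "A v \<bullet> 0 = v \<bullet> (A (P x) - P (A (P x)))"
      using Ps[of "A (P x)" v] by (simp add: inner_diff inner_commute)
  qed
  moreover have "A 0 = 0" using A_scale[of 0 0] real_vector.subspace_0[OF subspace_D] by simp
  ultimately show ?thesis by (simp add: P_def)
qed

lemma abs_quadratic_form_le:
  assumes "\<Lambda> > 0" and x: "E {-\<Lambda>..\<Lambda>} x = x"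
  shows "\<bar>A x \<bullet> x\<bar> \<le> \<Lambda> * (norm x)\<^sup>2"
proof -
  let ?M = "scalar_measure E x" and ?C = "{-\<Lambda>..\<Lambda>}"
  interpret finite_measure ?M by (rule finite_scalar_measure)
  have xD: "x \<in> D" using E_mem_D[of \<Lambda> x] x by simp
  \<comment> \<open>As \<open>x\<close> is fixed by \<open>E ?C\<close>, the indicator of
    \<open>?C\<close> enters the integrand, where \<open>s\<close> is bounded by
    \<open>\<Lambda>\<close>.\<close>
  have "A x \<bullet> x = (\<integral>s. indicator ?C s * s \<partial>?M)"
    using quadratic_form[OF xD] integral_scalar_measure_E[of ?C x] x by simp
  moreover have "norm (\<integral>s. indicator ?C s * s \<partial>?M) \<le> (\<integral>s. \<Lambda> \<partial>?M)"
  proof (rule Bochner_Integration.integral_norm_bound_integral)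
    show "integrable ?M (\<lambda>s. indicator ?C s * s)"
      using integrable_real_mult_indicator[OF _ integrable_scalar_measure[OF xD], of ?C]
      by (simp add: mult.commute)
  qed (use assms in \<open>auto simp: indicator_def\<close>)
  moreover have "(\<integral>s. \<Lambda> \<partial>?M) = \<Lambda> * (norm x)\<^sup>2"
    using emeasure_scalar_measure_UNIV[of x] by (simp add: measure_def)
  ultimately show ?thesis by (metis real_norm_def)
qed

lemma norm_A_le:
  assumes L: "\<Lambda> > 0"
  shows "norm (A (E {-\<Lambda>..\<Lambda>} x)) \<le> \<Lambda> * norm (E {-\<Lambda>..\<Lambda>} x)"
proof -
  interpret P: bounded_linear "E {-\<Lambda>..\<Lambda>}" by (rule E_linear) simp
  define p where "p = E {-\<Lambda>..\<Lambda>} x"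
  \<comment> \<open>Polarization, scaled so that both squared norms enter with the same factor.\<close>
  define q where "q = (1 / \<Lambda>) *\<^sub>R A p"
  have Pp: "E {-\<Lambda>..\<Lambda>} p = p"
    unfolding p_def by (rule orthogonal_projection_idem[OF E_projection]) simp
  have Pq: "E {-\<Lambda>..\<Lambda>} q = q"
    by (simp add: q_def P.scaleR p_def A_E_commute)
  have D: "p \<in> D" "q \<in> D" using E_mem_D[of \<Lambda> p] E_mem_D[of \<Lambda> q] by (simp_all add: Pp Pq)
  have "4 * (A p \<bullet> q) = A (p + q) \<bullet> (p + q) - A (p - q) \<bullet> (p - q)"
    using symmetric[OF D] by (simp add: A_add A_diff D inner_add inner_diff inner_commute)
  also have "\<dots> \<le> \<Lambda> * (norm (p + q))\<^sup>2 + \<Lambda> * (norm (p - q))\<^sup>2"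
    using abs_quadratic_form_le[OF L, of "p + q"] abs_quadratic_form_le[OF L, of "p - q"]
    by (simp add: P.add P.diff Pp Pq)
  \<comment> \<open>The parallelogram law. The left side is a multiple of the square of
    \<open>norm q\<close>, so what remains is \<open>norm q \<le> norm p\<close>, the claim up to
    scaling.\<close>
  also have "\<dots> = 2 * \<Lambda> * (norm p)\<^sup>2 + 2 * \<Lambda> * (norm q)\<^sup>2"
    by (simp add: power2_norm_eq_inner inner_add inner_diff algebra_simps)
  finally have "4 * (A p \<bullet> q) \<le> 2 * \<Lambda> * (norm p)\<^sup>2 + 2 * \<Lambda> * (norm q)\<^sup>2" .
  moreover have "A p \<bullet> q = \<Lambda> * (norm q)\<^sup>2" using L by (simp add: q_def power_divide dot_square_norm power2_eq_square)
  ultimately have "\<Lambda> * (norm q)\<^sup>2 \<le> \<Lambda> * (norm p)\<^sup>2" by linarith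
  then have "(norm q)\<^sup>2 \<le> (norm p)\<^sup>2" using L by (rule mult_left_le_imp_le)
  then have "norm q \<le> norm p" by (rule power2_le_imp_le) simp
  moreover have "A p = \<Lambda> *\<^sub>R q" using L by (simp add: q_def)
  ultimately have "norm (A p) \<le> \<Lambda> * norm p" using L by simp
  then show ?thesis by (simp only: p_def)
qed

text \<open>This everywhere defined operator replaces \<open>A\<close> in the Neumann
  series.\<close>

lemma bounded_linear_A_E:
  assumes "\<Lambda> > 0"
  shows "bounded_linear (\<lambda>x. A (E {-\<Lambda>..\<Lambda>} x))"
proof -
  interpret P: bounded_linear "E {-\<Lambda>..\<Lambda>}" by (rule E_linear) simp
  obtain K where K: "\<And>x. norm (E {-\<Lambda>..\<Lambda>} x) \<le> norm x * K" using P.bounded by blast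
  show ?thesis
  proof (rule bounded_linear_intro)
    show "norm (A (E {-\<Lambda>..\<Lambda>} x)) \<le> norm x * (K * \<Lambda>)" for x
      using order_trans[OF norm_A_le[OF assms] mult_left_mono[OF K[of x], of \<Lambda>]] assms
      by (simp add: mult_ac)
  qed (simp_all add: P.add P.scaleR A_add A_scale E_mem_D)
qed

end

subsection \<open>The evolution problem\<close>

text \<open>Derivatives within \<open>{0..T}\<close> are unique because \<open>T > 0\<close> makes
  the interval nondegenerate.\<close>

lemma time_deriv_eq:
  assumes "T > 0" and "t \<in> {0..T}" and "(u has_vector_derivative d) (at t within {0..T})"
  shows "time_deriv T u t = d"
  unfolding time_deriv_def by (rule vector_derivative_within_cbox[unfolded box_real]) (use assms in auto)

lemma C2_intoI:
  assumes T: "T > 0"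
    and u1: "\<And>t. t \<in> {0..T} \<Longrightarrow> (u has_vector_derivative u' t) (at t within {0..T})"
    and u2: "\<And>t. t \<in> {0..T} \<Longrightarrow> (u' has_vector_derivative u'' t) (at t within {0..T})"
    and c: "continuous_on {0..T} u''"
    and S: "\<And>t. t \<in> {0..T} \<Longrightarrow> u t \<in> S" "\<And>t. t \<in> {0..T} \<Longrightarrow> u' t \<in> S" "\<And>t. t \<in> {0..T} \<Longrightarrow> u'' t \<in> S"
  shows "C2_into T S u" and "\<And>t. t \<in> {0..T} \<Longrightarrow> time_deriv T u t = u' t"
    and "\<And>t. t \<in> {0..T} \<Longrightarrow> time_deriv T (time_deriv T u) t = u'' t"
proof -
  show 1: "time_deriv T u t = u' t" if "t \<in> {0..T}" for t
    by (rule time_deriv_eq[OF T that u1[OF that]])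
  have 2: "(time_deriv T u has_vector_derivative u'' t) (at t within {0..T})" if t: "t \<in> {0..T}" for t
    by (rule has_vector_derivative_transform[OF t _ u2[OF t]]) (rule 1)
  show 3: "time_deriv T (time_deriv T u) t = u'' t" if "t \<in> {0..T}" for t
    by (rule time_deriv_eq[OF T that 2[OF that]])
  have "continuous_on {0..T} (time_deriv T (time_deriv T u))"
    using c by (subst continuous_on_cong[OF refl 3]) auto
  then show "C2_into T S u" unfolding C2_into_def using u1 2 S by (simp add: 1 3)
qed

lemma C2_into_continuous:
  assumes "C2_into T S u"
  shows "continuous_on {0..T} u"
  using assms unfolding C2_into_def by (intro continuous_on_vector_derivative) blast

lemma volterra_cong:
  "(\<And>s. s \<in> {0..t} \<Longrightarrow> p s = q s) \<Longrightarrow> volterra h p t = volterra h q t"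
  unfolding volterra_def by (rule integral_cong) simp

lemma volterra3_cong:
  assumes "\<And>s. s \<in> {0..t} \<Longrightarrow> p s = q s"
  shows "volterra3 h p t = volterra3 h q t"
  unfolding volterra3_def by (intro integral_cong volterra_cong assms) auto

text \<open>The fundamental theorem of calculus, applied first to \<open>time_deriv T u\<close> and
  then to \<open>u\<close>.\<close>

lemma solves_problem_imp_volterra3:
  assumes u: "C2_into T UNIV u" and Au: "continuous_on {0..T} (\<lambda>t. A (u t))"
    and sol: "solves_problem T A h f u0 u1 u"
    and h: "continuous_on {0..T} h" and f: "continuous_on {0..T} f" and t: "t \<in> {0..T}"
  shows "u t = u0 + t *\<^sub>R u1 + integral {0..t} (\<lambda>r. integral {0..r} f) + volterra3 h (\<lambda>s. A (u s)) t"
proof -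
  let ?V = "volterra h (\<lambda>s. A (u s))"
  have cV: "continuous_on {0..T} ?V" by (rule continuous_on_volterra[OF h Au])
  have d1: "(u has_vector_derivative time_deriv T u t) (at t within {0..T})"
    and d2: "(time_deriv T u has_vector_derivative ?V t + f t) (at t within {0..T})"
    if "t \<in> {0..T}" for t
    using u sol that by (simp_all add: C2_into_def solves_problem_def volterra_def)
  have ic: "p integrable_on {0..r}" if "continuous_on {0..T} p" "r \<in> {0..T}" for p :: "real \<Rightarrow> 'a" and r
    by (intro integrable_continuous_interval continuous_on_subset[OF that(1)]) (use that in auto)
  have 1: "time_deriv T u r = u1 + (integral {0..r} ?V + integral {0..r} f)" if r: "r \<in> {0..T}" for r
  proof -
    have "((\<lambda>s. ?V s + f s) has_integral (time_deriv T u r - time_deriv T u 0)) {0..r}"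
      by (rule fundamental_theorem_of_calculus)
        (use r in \<open>auto intro!: has_vector_derivative_within_subset[OF d2]\<close>)
    then have "time_deriv T u r - time_deriv T u 0 = integral {0..r} (\<lambda>s. ?V s + f s)"
      by (simp add: integral_unique)
    also have "\<dots> = integral {0..r} ?V + integral {0..r} f"
      by (intro Henstock_Kurzweil_Integration.integral_add ic cV f r)
    finally show ?thesis using sol by (simp add: solves_problem_def algebra_simps)
  qed
  have "((\<lambda>r. time_deriv T u r) has_integral (u t - u 0)) {0..t}"
    by (rule fundamental_theorem_of_calculus)
      (use t in \<open>auto intro!: has_vector_derivative_within_subset[OF d1]\<close>)
  then have "u t - u 0 = integral {0..t} (time_deriv T u)" by (simp add: integral_unique)
  also have "\<dots> = integral {0..t} (\<lambda>r. u1 + (integral {0..r} ?V + integral {0..r} f))"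
    by (rule integral_cong) (use 1 t in auto)
  also have "\<dots> = t *\<^sub>R u1 + (volterra3 h (\<lambda>s. A (u s)) t + integral {0..t} (\<lambda>r. integral {0..r} f))"
  proof -
    note cI = continuous_on_integral_upper[OF cV] continuous_on_integral_upper[OF f]
    have "integral {0..t} (\<lambda>r. u1 + (integral {0..r} ?V + integral {0..r} f))
        = integral {0..t} (\<lambda>r. u1) + integral {0..t} (\<lambda>r. integral {0..r} ?V + integral {0..r} f)"
      by (intro Henstock_Kurzweil_Integration.integral_add ic continuous_on_add cI t continuous_on_const)
    also have "integral {0..t} (\<lambda>r. integral {0..r} ?V + integral {0..r} f)
        = integral {0..t} (\<lambda>r. integral {0..r} ?V) + integral {0..t} (\<lambda>r. integral {0..r} f)"
      by (intro Henstock_Kurzweil_Integration.integral_add ic cI t)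
    finally show ?thesis using t by (simp add: volterra3_def)
  qed
  finally show ?thesis using sol by (simp add: solves_problem_def algebra_simps)
qed

section \<open>Uniqueness in the domain of \<open>A\<close>\<close>

context real_selfadjoint
begin

lemma solves_problem_unique:
  assumes h: "continuous_on {0..T} h" and f: "continuous_on {0..T} f"
    and u: "C2_into T UNIV u" "C0_into_domain T D A u" "solves_problem T A h f u0 u1 u"
    and v: "C2_into T UNIV v" "C0_into_domain T D A v" "solves_problem T A h f u0 u1 v"
    and t: "t \<in> {0..T}"
  shows "u t = v t"
proof -
  have c: "continuous_on {0..T} g" "continuous_on {0..T} (\<lambda>t. A (g t))" "\<And>t. t \<in> {0..T} \<Longrightarrow> g t \<in> D"
    if "C0_into_domain T D A g" for g
    using that continuous_on_fst[of "{0..T}" "\<lambda>t. (g t, A (g t))"]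
      continuous_on_snd[of "{0..T}" "\<lambda>t. (g t, A (g t))"] by (auto simp: C0_into_domain_def)
  note cu = c[OF u(2)] and cv = c[OF v(2)]
  have A: "A (u s - v s) = A (u s) - A (v s)" if "s \<in> {0..T}" for s
    by (rule A_diff[OF cu(3) cv(3)]) (rule that)+
  have "u t - v t = 0"
  proof (rule volterra3_homogeneous_unique[OF h _ _ _ _ t])
    show "continuous_on {0..T} (\<lambda>t. u t - v t)" by (intro continuous_intros cu cv)
    have "continuous_on {0..T} (\<lambda>t. A (u t) - A (v t))" by (intro continuous_intros cu cv)
    then show "continuous_on {0..T} (\<lambda>t. A (u t - v t))" using A by (subst continuous_on_cong[OF refl A])
    show "u s - v s \<in> D" if "s \<in> {0..T}" for s using cu(3)[OF that] cv(3)[OF that] subspace_diff subspace_D by blast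
    fix s assume s: "s \<in> {0..T}"
    have "volterra3 h (\<lambda>s. A (u s - v s)) s = volterra3 h (\<lambda>s. A (u s) - A (v s)) s"
      by (rule volterra3_cong) (use A s in auto)
    also have "\<dots> = volterra3 h (\<lambda>s. A (u s)) s - volterra3 h (\<lambda>s. A (v s)) s"
      by (rule volterra3_diff[OF h cu(2) cv(2) s])
    also have "\<dots> = u s - v s"
      using solves_problem_imp_volterra3[OF u(1) cu(2) u(3) h f s]
        solves_problem_imp_volterra3[OF v(1) cv(2) v(3) h f s] by simp
    finally show "u s - v s = volterra3 h (\<lambda>s. A (u s - v s)) s" ..
  qed
  then show ?thesis by simp
qed

end

section \<open>Existence in the spectral subspace\<close>

context rc_spectral
begin

lemma spectral_subspace_iff: "x \<in> spectral_subspace E \<Lambda> \<longleftrightarrow> E {-\<Lambda>..\<Lambda>} x = x"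
proof
  assume "x \<in> spectral_subspace E \<Lambda>"
  then obtain y where "x = E {-\<Lambda>..\<Lambda>} y" by (auto simp: spectral_subspace_def)
  then show "E {-\<Lambda>..\<Lambda>} x = x" by (simp add: orthogonal_projection_idem[OF E_projection])
next
  assume "E {-\<Lambda>..\<Lambda>} x = x"
  then show "x \<in> spectral_subspace E \<Lambda>" unfolding spectral_subspace_def by (rule range_eqI[OF sym])
qed

text \<open>On the subspace \<open>A\<close> agrees with a bounded operator, so continuity in the
  graph norm is automatic and the general uniqueness result becomes applicable.\<close>

lemma C2_into_spectral_subspace:
  assumes L: "\<Lambda> > 0" and u: "C2_into T (spectral_subspace E \<Lambda>) u"
  shows "C2_into T UNIV u" "C0_into_domain T D A u"
proof -
  show "C2_into T UNIV u" using u by (simp add: C2_into_def)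
  have S: "E {-\<Lambda>..\<Lambda>} (u t) = u t" if "t \<in> {0..T}" for t
    using u that by (simp add: C2_into_def spectral_subspace_iff)
  have cu: "continuous_on {0..T} u" by (rule C2_into_continuous[OF u])
  have "continuous_on {0..T} (\<lambda>t. A (E {-\<Lambda>..\<Lambda>} (u t)))"
    by (rule bounded_linear.continuous_on[OF bounded_linear_A_E[OF L] cu])
  then have "continuous_on {0..T} (\<lambda>t. A (u t))" by (rule continuous_on_eq) (simp add: S)
  moreover have "u t \<in> D" if "t \<in> {0..T}" for t using E_mem_D[of \<Lambda> "u t"] S[OF that] by simp
  ultimately show "C0_into_domain T D A u"
    unfolding C0_into_domain_def by (intro conjI ballI continuous_on_Pair cu)
qed

text \<open>The bounded projection fixes \<open>u\<close>, hence also its unique derivative.\<close>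

lemma spectral_subspace_derivative:
  assumes T: "T > 0" and u: "\<And>t. t \<in> {0..T} \<Longrightarrow> u t \<in> spectral_subspace E \<Lambda>"
    and t: "t \<in> {0..T}" and d: "(u has_vector_derivative d) (at t within {0..T})"
  shows "d \<in> spectral_subspace E \<Lambda>"
proof -
  have "((\<lambda>t. E {-\<Lambda>..\<Lambda>} (u t)) has_vector_derivative E {-\<Lambda>..\<Lambda>} d) (at t within {0..T})"
    by (rule bounded_linear.has_vector_derivative[OF E_linear d]) simp
  then have "(u has_vector_derivative E {-\<Lambda>..\<Lambda>} d) (at t within {0..T})"
    by (rule has_vector_derivative_transform[OF t, rotated]) (use u in \<open>auto simp: spectral_subspace_iff\<close>)
  from time_deriv_eq[OF T t this] time_deriv_eq[OF T t d] show ?thesis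
    by (simp add: spectral_subspace_iff)
qed

text \<open>Solve the integral equation with the bounded \<open>B\<close> in place of
  \<open>A\<close>. The projection \<open>P\<close> fixes \<open>q\<close> and all values of
  \<open>B\<close>, hence also \<open>u\<close>, and on such values \<open>B\<close> agrees with
  \<open>A\<close>.\<close>

lemma solves_problem_exists:
  assumes L: "\<Lambda> > 0" and T: "T > 0"
    and h: "continuous_on {0..T} h" and f: "continuous_on {0..T} f"
    and u0: "u0 \<in> spectral_subspace E \<Lambda>" and u1: "u1 \<in> spectral_subspace E \<Lambda>"
    and fS: "\<And>t. t \<in> {0..T} \<Longrightarrow> f t \<in> spectral_subspace E \<Lambda>"
  shows "\<exists>u. C2_into T (spectral_subspace E \<Lambda>) u \<and> solves_problem T A h f u0 u1 u"
proof -
  define P where "P = E {-\<Lambda>..\<Lambda>}"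
  define B where "B = (\<lambda>x. A (P x))"
  have P: "bounded_linear P" unfolding P_def by (rule E_linear) simp
  interpret P: bounded_linear P by (rule P)
  have B: "bounded_linear B" unfolding B_def P_def by (rule bounded_linear_A_E[OF L])
  have PB: "P (B x) = B x" for x unfolding B_def P_def by (rule A_E_commute)
  have PS: "x \<in> spectral_subspace E \<Lambda> \<longleftrightarrow> P x = x" for x unfolding P_def by (rule spectral_subspace_iff)
  define q where "q = (\<lambda>t. u0 + t *\<^sub>R u1 + integral {0..t} (\<lambda>r. integral {0..r} f))"
  have cf: "continuous_on {0..T} (\<lambda>r. integral {0..r} f)" by (rule continuous_on_integral_upper[OF f])
  have cq: "continuous_on {0..T} q"
    unfolding q_def by (intro continuous_intros continuous_on_integral_upper f)
  from volterra3_fixpoint[OF h cq B] obtain u where cu: "continuous_on {0..T} u"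
    and u: "\<And>t. t \<in> {0..T} \<Longrightarrow> u t = q t + volterra3 h (\<lambda>s. B (u s)) t" by blast
  have cB: "continuous_on {0..T} (\<lambda>s. B (u s))" by (rule bounded_linear.continuous_on[OF B cu])
  have cV: "continuous_on {0..T} (volterra h (\<lambda>s. B (u s)))" by (rule continuous_on_volterra[OF h cB])
  have Pint: "P (integral {0..t} g) = integral {0..t} g"
    if g: "continuous_on {0..T} g" "\<And>s. s \<in> {0..T} \<Longrightarrow> P (g s) = g s" and t: "t \<in> {0..T}" for g t
  proof -
    have "g integrable_on {0..t}"
      by (intro integrable_continuous_interval continuous_on_subset[OF g(1)]) (use t in auto)
    from integral_linear[OF this P] have "P (integral {0..t} g) = integral {0..t} (\<lambda>s. P (g s))"
      by (simp add: o_def)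
    also have "\<dots> = integral {0..t} g" by (rule integral_cong) (use g(2) t in auto)
    finally show ?thesis .
  qed
  have uS: "u t \<in> spectral_subspace E \<Lambda>" if t: "t \<in> {0..T}" for t
  proof -
    have "P (integral {0..t} (\<lambda>r. integral {0..r} f)) = integral {0..t} (\<lambda>r. integral {0..r} f)"
      by (intro Pint cf t f) (use fS PS in auto)
    then have "P (q t) = q t" using u0 u1 by (simp add: q_def P.add P.scaleR PS)
    moreover have "P (volterra3 h (\<lambda>s. B (u s)) t) = volterra3 h (\<lambda>s. B (u s)) t"
      unfolding bounded_linear_volterra3[OF P h cB t] PB ..
    ultimately show ?thesis by (simp add: u[OF t] PS P.add)
  qed
  define u' where "u' = (\<lambda>t. u1 + integral {0..t} f + integral {0..t} (volterra h (\<lambda>s. B (u s))))"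
  define u'' where "u'' = (\<lambda>t. f t + volterra h (\<lambda>s. B (u s)) t)"
  have d1: "(u has_vector_derivative u' t) (at t within {0..T})" if t: "t \<in> {0..T}" for t
  proof (rule has_vector_derivative_transform[OF t u])
    have *: "((\<lambda>t. integral {0..t} (\<lambda>r. integral {0..r} g)) has_vector_derivative integral {0..t} g) (at t within {0..T})"
      if "continuous_on {0..T} g" for g :: "real \<Rightarrow> 'h"
      by (rule integral_has_vector_derivative[OF continuous_on_integral_upper[OF that] t])
    show "((\<lambda>t. q t + volterra3 h (\<lambda>s. B (u s)) t) has_vector_derivative u' t) (at t within {0..T})"
      unfolding q_def volterra3_def u'_def
      by (rule derivative_eq_intros *[OF f] *[OF cV] refl | simp)+
  qed
  have d2: "(u' has_vector_derivative u'' t) (at t within {0..T})" if t: "t \<in> {0..T}" for t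
    unfolding u'_def u''_def
    by (rule derivative_eq_intros integral_has_vector_derivative[OF f t]
        integral_has_vector_derivative[OF cV t] refl | simp)+
  have u'S: "u' t \<in> spectral_subspace E \<Lambda>" if t: "t \<in> {0..T}" for t
    by (rule spectral_subspace_derivative[OF T uS t d1[OF t]])
  have u''S: "u'' t \<in> spectral_subspace E \<Lambda>" if t: "t \<in> {0..T}" for t
    by (rule spectral_subspace_derivative[OF T u'S t d2[OF t]])
  have cu'': "continuous_on {0..T} u''" unfolding u''_def by (intro continuous_intros f cV)
  have C2: "C2_into T (spectral_subspace E \<Lambda>) u"
    by (rule C2_intoI) (fact T d1 d2 cu'' uS u'S u''S)+
  have u'_eq: "time_deriv T u t = u' t" if "t \<in> {0..T}" for t
    by (rule C2_intoI(2)) (fact that T d1 d2 cu'' uS u'S u''S)+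
  have u''_eq: "time_deriv T (time_deriv T u) t = u'' t" if "t \<in> {0..T}" for t
    by (rule C2_intoI(3)) (fact that T d1 d2 cu'' uS u'S u''S)+
  have "solves_problem T A h f u0 u1 u"
    unfolding solves_problem_def
  proof (intro conjI ballI)
    have "0 \<in> {0..T}" using T by simp
    then show "u 0 = u0" "time_deriv T u 0 = u1"
      using u[of 0] u'_eq[of 0] by (simp_all add: q_def volterra3_def u'_def)
    fix t assume t: "t \<in> {0..T}"
    have "volterra h (\<lambda>s. B (u s)) t = volterra h (\<lambda>s. A (u s)) t"
      by (rule volterra_cong) (use uS t in \<open>auto simp: B_def PS\<close>)
    then show "time_deriv T (time_deriv T u) t = integral {0..t} (\<lambda>s. h (t - s) *\<^sub>R A (u s)) + f t"
      using u''_eq[OF t] by (simp add: u''_def volterra_def)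
  qed
  with C2 show ?thesis by blast
qed

end

theorem theorem3p1:
  fixes scl :: "'k::rc_field \<Rightarrow> 'h::{real_inner, banach} \<Rightarrow> 'h"
    and ip :: "'h \<Rightarrow> 'h \<Rightarrow> 'k"
    and D :: "'h set" and A :: "'h \<Rightarrow> 'h"
    and T :: real and h :: "real \<Rightarrow> real" and f :: "real \<Rightarrow> 'h" and u0 u1 :: 'h
  assumes "rc_hilbert scl ip"
    and "selfadjoint_operator scl ip D A"
    and "T > 0"
    and "continuous_on {0..T} h"
    and "continuous_on {0..T} f"
    and "u0 \<in> D"
  shows "(\<forall>u v. C2_into T UNIV u \<and> C0_into_domain T D A u \<and> solves_problem T A h f u0 u1 u \<and>
                C2_into T UNIV v \<and> C0_into_domain T D A v \<and> solves_problem T A h f u0 u1 v \<longrightarrow>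
                (\<forall>t\<in>{0..T}. u t = v t)) \<and>
         (\<forall>E \<Lambda>. spectral_measure_of scl ip D A E \<and> \<Lambda> > 0 \<and>
                u0 \<in> spectral_subspace E \<Lambda> \<and> u1 \<in> spectral_subspace E \<Lambda> \<and>
                (\<forall>t\<in>{0..T}. f t \<in> spectral_subspace E \<Lambda>) \<longrightarrow>
                (\<exists>u. C2_into T (spectral_subspace E \<Lambda>) u \<and> solves_problem T A h f u0 u1 u \<and>
                   (\<forall>v. C2_into T (spectral_subspace E \<Lambda>) v \<and> solves_problem T A h f u0 u1 v \<longrightarrow>
                      (\<forall>t\<in>{0..T}. v t = u t))))"
proof (intro conjI allI impI ballI; (elim conjE)?)
  interpret rc_hilbert scl ip by fact
  interpret real_selfadjoint D A by (rule real_selfadjoint_if_selfadjoint) fact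
  show "u t = v t" if "C2_into T UNIV u" "C0_into_domain T D A u" "solves_problem T A h f u0 u1 u"
    "C2_into T UNIV v" "C0_into_domain T D A v" "solves_problem T A h f u0 u1 v" "t \<in> {0..T}" for u v t
    by (rule solves_problem_unique[OF assms(4,5) that])
  fix E \<Lambda>
  assume "spectral_measure_of scl ip D A E" and L: "\<Lambda> > 0"
    and S: "u0 \<in> spectral_subspace E \<Lambda>" "u1 \<in> spectral_subspace E \<Lambda>"
      "\<forall>t\<in>{0..T}. f t \<in> spectral_subspace E \<Lambda>"
  then interpret rc_spectral scl ip D A E by unfold_locales
  obtain u where u: "C2_into T (spectral_subspace E \<Lambda>) u" "solves_problem T A h f u0 u1 u"
    using solves_problem_exists[OF L assms(3-5)] S by blast
  moreover have "v t = u t"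
    if "C2_into T (spectral_subspace E \<Lambda>) v" "solves_problem T A h f u0 u1 v" "t \<in> {0..T}" for v t
    by (rule solves_problem_unique[OF assms(4,5) C2_into_spectral_subspace[OF L that(1)] that(2)
        C2_into_spectral_subspace[OF L u(1)] u(2) that(3)])
  ultimately show "\<exists>u. C2_into T (spectral_subspace E \<Lambda>) u \<and> solves_problem T A h f u0 u1 u \<and>
       (\<forall>v. C2_into T (spectral_subspace E \<Lambda>) v \<and> solves_problem T A h f u0 u1 v \<longrightarrow>
          (\<forall>t\<in>{0..T}. v t = u t))" by blast
qed

end
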